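(* Let $(\mathcal L;\leq,\odot,1)$ be a non-trivial q.n.c. tomonoid, let $F$ be a non-trivial Archimedean filter of $\mathcal L$ such that each $F$-class is order-isomorphic to a real interval, and let $\mathcal P$ be the quotient of $\mathcal L$ by $F$. Let $R\in\mathcal P$ be such that $R$ is not a singleton. With $F$ identified with $[0,1]$ (if $F$ is a Łukasiewicz tomonoid) or with $(0,1]$ (if $F$ is a product tomonoid), the following hold. (i) Assume that $F$ is a Łukasiewicz tomonoid. Then $\Lambda^R$ is Łukasiewicz. Furthermore, there is an $\alpha\geq 1$ such that, under the identification of $R$ with the real interval $[0,1]$, the homomorphism $\varrho_R\colon F\to\Lambda^R$ is given by \[ \varrho_R(f)\colon[0,1]\to[0,1],\quad r\mapsto (r+\alpha(f-1))\vee 0,\qquad f\in F. \] (ii) Assume that $F$ is a product tomonoid and $\Lambda^R$ is Łukasiewicz. Then there is an $\alpha>0$ such that, under the identification of $R$ with $[0,1]$, \[ \varrho_R(f)\colon[0,1]\to[0,1],\quad r\mapsto (r+\alpha\ln f)\vee 0,\qquad f\in F. \] (iii) Assume that $F$ is a product tomonoid and $\Lambda^R$ is product. Then there is an $\alpha>0$ such that, under the identification of $R$ with $(0,1]$, \[ \varrho_R(f)\colon(0,1]\to(0,1],\quad r\mapsto f^\alpha r,\qquad f\in F. \] (iv) Assume that $F$ is a product tomonoid and $\Lambda^R$ is reversed product. Then there is an $\alpha>0$ such that, under the identification of $R$ with $[0,1)$, \[ \varrho_R(f)\colon[0,1)\to[0,1),\quad r\mapsto \Bigl(1-\tfrac{1-r}{f^\alpha}\Bigr)\vee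 0,\qquad f\in F. \] (v) Assume that $F$ is a product tomonoid and $\Lambda^R$ is power. Then there is an $\alpha>0$ such that, under the identification of $R$ with $(0,1)$, \[ \varrho_R(f)\colon(0,1)\to(0,1),\quad r\mapsto r^{1/f^\alpha},\qquad f\in F. \]
   Context: For reals, $\wedge,\vee$ denote minimum and maximum. Tomonoids. A tomonoid is a structure $(\mathcal L;\leq,\odot,1)$ where $(\mathcal L;\odot,1)$ is a monoid and $\leq$ is a total order such that $a\leq b$, $c\leq d$ imply $a\odot c\leq b\odot d$. It is commutative if $\odot$ is; negative if $a\leq 1$ for all $a$; quantic if every non-empty subset has a supremum and $a\odot\bigvee_\iota b_\iota=\bigvee_\iota(a\odot b_\iota)$, $(\bigvee_\iota b_\iota)\odot a=\bigvee_\iota(b_\iota\odot a)$ for all $a$ and all non-empty families $(b_\iota)$. "q.n.c." means quantic, negative, commutative. A tomonoid is trivial if it consists of $1$ alone. It is Archimedean if for all $a<b<1$ there is $n\geq1$ with $b^n\leq a$. Isomorphisms of tomonoids preserve and reflect order and preserve $\odot$ and $1$. Filters and quotients. A filter of $\mathcal L$ is a subset $F\ni 1$ closed under $\odot$ and upward closed, regarded as a tomonoid with the restricted structure; it is non-trivial if $F\neq\{1\}$. The congruence induced by $F$: $a\sim_F b$ iff $a=b$, or $a<b$ and $b\odot f\leq a$ for some $f\in F$, or $b<a$ and $a\odot f\leq b$ for some $f\in F$. Its classes, which are intervals of $\mathcal L$, are the $F$-classes; the quotient $\mathcal P$ of $\mathcal L$ by $F$ is the set of $F$-classes, ordered by $R\leq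 S$ iff $a\leq b$ for some $a\in R,b\in S$, with the induced product $\odot$ and identity $F$; it is again q.n.c. A real interval is a singleton or a set $(a,b),(a,b],[a,b)$ or $[a,b]$ with $a<b$ in $\mathbb R$. Translations. For $a\in\mathcal L$ let $\lambda_a\colon\mathcal L\to\mathcal L$, $x\mapsto a\odot x$. For an $F$-class $R$ and $f\in F$, let $\lambda_f^R\colon R\to R$ be the restriction of $\lambda_f$ to $R$; $\Lambda^R=\{\lambda^R_f : f\in F\}$, and $\varrho_R\colon F\to\Lambda^R$, $f\mapsto\lambda^R_f$ (a surjective, order-preserving monoid homomorphism). Composition tomonoids. A composition tomonoid on a chain $R$ is a set $\Phi$ of order-preserving maps $R\to R$ that is totally ordered by the pointwise order, closed under composition, and contains $\mathrm{id}_R$. $\Phi$ on $R$ and $\Psi$ on $S$ are c-isomorphic if there is an order isomorphism $\phi\colon R\to S$ with $\Psi=\{\phi\circ\lambda\circ\phi^{-1}:\lambda\in\Phi\}$. A composition tomonoid is called: Łukasiewicz if it is c-isomorphic to $\{[0,1]\to[0,1],\,x\mapsto(x+t-1)\vee0 : t\in[0,1]\}$; product if c-isomorphic to $\{(0,1]\to(0,1],\,x\mapsto tx : t\in(0,1]\}$; reversed product if c-isomorphic to $\{[0,1)\to[0,1),\,x\mapsto\frac{(x+t-1)\vee0}{t}: t\in(0,1]\}$; power if c-isomorphic to $\{(0,1)\to(0,1),\,x\mapsto x^{1/t}: t\in(0,1]\}$. A tomonoid is Łukasiewicz if it is isomorphic to $([0,1];\leq,\star,1)$ with $a\star b=(a+b-1)\vee0$,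 and product if isomorphic to $((0,1];\leq,\cdot,1)$. (Known: under the present assumptions $F$ is Łukasiewicz if it has a smallest element and product otherwise; and $\Lambda^R$ for a non-singleton $R$ is Łukasiewicz, product, reversed product or power according to whether $R$ has a smallest and largest / only a largest / only a smallest / neither element.) Identifications. $F$ is identified with $[0,1]$ or $(0,1]$ by means of a tomonoid isomorphism from $F$ onto $([0,1];\leq,\star,1)$, where $a\star b=(a+b-1)\vee0$ (if $F$ is Łukasiewicz), or onto $((0,1];\leq,\cdot,1)$, where $\cdot$ is the usual product of reals (if $F$ is product), so that $f\in F$ is treated as a real number. $R$ is identified with $[0,1]$, $(0,1]$, $[0,1)$ or $(0,1)$, respectively, by means of an order isomorphism that is a c-isomorphism from $\Lambda^R$ to the respective canonical composition tomonoid, that is, to $\{[0,1]\to[0,1],\,x\mapsto(x+t-1)\vee0 : t\in[0,1]\}$ if $\Lambda^R$ is Łukasiewicz, to $\{(0,1]\to(0,1],\,x\mapsto tx : t\in(0,1]\}$ if $\Lambda^R$ is product, to $\{[0,1)\to[0,1),\,x\mapsto\frac{(x+t-1)\vee0}{t}: t\in(0,1]\}$ if $\Lambda^R$ is reversed product, and to $\{(0,1)\to(0,1),\,x\mapsto x^{1/t}: t\in(0,1]\}$ if $\Lambda^R$ is power. *)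

theory Defs
  imports Complex_Main "HOL-Algebra.Group"
begin

section \<open>Chains\<close>

definition totally_ordered :: "'a set \<Rightarrow> ('a \<Rightarrow> 'a \<Rightarrow> bool) \<Rightarrow> bool" where
  "totally_ordered A leq \<longleftrightarrow>
     reflp_on A leq \<and> transp_on A leq \<and> antisymp_on A leq \<and> totalp_on A leq"

definition order_isos ::
    "'a set \<Rightarrow> ('a \<Rightarrow> 'a \<Rightarrow> bool) \<Rightarrow> 'b set \<Rightarrow> ('b \<Rightarrow> 'b \<Rightarrow> bool) \<Rightarrow> ('a \<Rightarrow> 'b) set" where
  "order_isos A leA B leB =
     {\<phi>. bij_betw \<phi> A B \<and> (\<forall>x\<in>A. \<forall>y\<in>A. leA x y \<longleftrightarrow> leB (\<phi> x) (\<phi> y))}"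

definition real_interval :: "real set \<Rightarrow> bool" where
  "real_interval S \<longleftrightarrow> (\<exists>a. S = {a}) \<or>
     (\<exists>a b. a < b \<and> (S = {a<..<b} \<or> S = {a<..b} \<or> S = {a..<b} \<or> S = {a..b}))"


section \<open>Tomonoids\<close>

text \<open>Only the restriction of the order to the carrier is meaningful, so that
  a filter \<open>F\<close> of \<open>L\<close> with the restricted structure is \<open>L\<lparr>carrier := F\<rparr>\<close>.\<close>

record 'a tomonoid = "'a monoid" +
  tle :: "'a \<Rightarrow> 'a \<Rightarrow> bool" (infix "\<preceq>\<index>" 50)

abbreviation tless :: "('a, 'm) tomonoid_scheme \<Rightarrow> 'a \<Rightarrow> 'a \<Rightarrow> bool" (infix "\<prec>\<index>" 50) where
  "a \<prec>\<^bsub>L\<^esub> b \<equiv> a \<preceq>\<^bsub>L\<^esub> b \<and> a \<noteq> b"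

definition is_sup :: "('a, 'm) tomonoid_scheme \<Rightarrow> 'a set \<Rightarrow> 'a \<Rightarrow> bool" where
  "is_sup L A s \<longleftrightarrow> s \<in> carrier L \<and> (\<forall>a\<in>A. a \<preceq>\<^bsub>L\<^esub> s) \<and>
     (\<forall>u\<in>carrier L. (\<forall>a\<in>A. a \<preceq>\<^bsub>L\<^esub> u) \<longrightarrow> s \<preceq>\<^bsub>L\<^esub> u)"

locale tomonoid = monoid L for L :: "('a, 'm) tomonoid_scheme" (structure) +
  assumes total_order: "totally_ordered (carrier L) (\<preceq>)"
    and mult_le_mono: "\<lbrakk>a \<in> carrier L; b \<in> carrier L; c \<in> carrier L; d \<in> carrier L; a \<preceq> b; c \<preceq> d\<rbrakk>
      \<Longrightarrow> a \<otimes> c \<preceq> b \<otimes> d"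

locale qnc_tomonoid = tomonoid L + comm_monoid L for L (structure) +
  assumes sup_exists: "\<lbrakk>A \<subseteq> carrier L; A \<noteq> {}\<rbrakk> \<Longrightarrow> \<exists>s. is_sup L A s"
    and mult_sup_left: "\<lbrakk>a \<in> carrier L; A \<subseteq> carrier L; A \<noteq> {}; is_sup L A s\<rbrakk>
      \<Longrightarrow> is_sup L ((\<lambda>b. a \<otimes> b) ` A) (a \<otimes> s)"
    and mult_sup_right: "\<lbrakk>a \<in> carrier L; A \<subseteq> carrier L; A \<noteq> {}; is_sup L A s\<rbrakk>
      \<Longrightarrow> is_sup L ((\<lambda>b. b \<otimes> a) ` A) (s \<otimes> a)"
    and negative: "a \<in> carrier L \<Longrightarrow> a \<preceq> \<one>"

definition trivial_tomonoid :: "('a, 'm) tomonoid_scheme \<Rightarrow> bool" where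
  "trivial_tomonoid L \<longleftrightarrow> carrier L = {\<one>\<^bsub>L\<^esub>}"

definition archimedean :: "('a, 'm) tomonoid_scheme \<Rightarrow> bool" where
  "archimedean L \<longleftrightarrow> (\<forall>a\<in>carrier L. \<forall>b\<in>carrier L. a \<prec>\<^bsub>L\<^esub> b \<and> b \<prec>\<^bsub>L\<^esub> \<one>\<^bsub>L\<^esub> \<longrightarrow>
     (\<exists>n::nat. n \<ge> 1 \<and> b [^]\<^bsub>L\<^esub> n \<preceq>\<^bsub>L\<^esub> a))"

definition tomonoid_isos ::
    "('a, 'm) tomonoid_scheme \<Rightarrow> ('b, 'n) tomonoid_scheme \<Rightarrow> ('a \<Rightarrow> 'b) set" where
  "tomonoid_isos L M = {h \<in> iso L M. h \<one>\<^bsub>L\<^esub> = \<one>\<^bsub>M\<^esub> \<and>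
     (\<forall>a\<in>carrier L. \<forall>b\<in>carrier L. a \<preceq>\<^bsub>L\<^esub> b \<longleftrightarrow> h a \<preceq>\<^bsub>M\<^esub> h b)}"

definition lukasiewicz_unit :: "real tomonoid" where
  "lukasiewicz_unit =
     \<lparr>carrier = {0..1}, mult = (\<lambda>a b. max (a + b - 1) 0), one = 1, tle = (\<le>)\<rparr>"

definition product_unit :: "real tomonoid" where
  "product_unit = \<lparr>carrier = {0<..1}, mult = (*), one = 1, tle = (\<le>)\<rparr>"

definition lukasiewicz_tomonoid :: "('a, 'm) tomonoid_scheme \<Rightarrow> bool" where
  "lukasiewicz_tomonoid L \<longleftrightarrow> tomonoid_isos L lukasiewicz_unit \<noteq> {}"

definition product_tomonoid :: "('a, 'm) tomonoid_scheme \<Rightarrow> bool" where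
  "product_tomonoid L \<longleftrightarrow> tomonoid_isos L product_unit \<noteq> {}"


section \<open>Filters and quotients\<close>

definition tomonoid_filter :: "('a, 'm) tomonoid_scheme \<Rightarrow> 'a set \<Rightarrow> bool" where
  "tomonoid_filter L F \<longleftrightarrow> F \<subseteq> carrier L \<and> \<one>\<^bsub>L\<^esub> \<in> F \<and> (\<forall>a\<in>F. \<forall>b\<in>F. a \<otimes>\<^bsub>L\<^esub> b \<in> F) \<and>
     (\<forall>a\<in>F. \<forall>b\<in>carrier L. a \<preceq>\<^bsub>L\<^esub> b \<longrightarrow> b \<in> F)"

definition filter_cong :: "('a, 'm) tomonoid_scheme \<Rightarrow> 'a set \<Rightarrow> ('a \<times> 'a) set" where
  "filter_cong L F = {(a, b). a \<in> carrier L \<and> b \<in> carrier L \<and>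
     (a = b \<or> a \<prec>\<^bsub>L\<^esub> b \<and> (\<exists>f\<in>F. b \<otimes>\<^bsub>L\<^esub> f \<preceq>\<^bsub>L\<^esub> a) \<or> b \<prec>\<^bsub>L\<^esub> a \<and> (\<exists>f\<in>F. a \<otimes>\<^bsub>L\<^esub> f \<preceq>\<^bsub>L\<^esub> b))}"

definition filter_quotient :: "('a, 'm) tomonoid_scheme \<Rightarrow> 'a set \<Rightarrow> 'a set tomonoid" where
  "filter_quotient L F =
     \<lparr>carrier = carrier L // filter_cong L F,
      mult = (\<lambda>R S. \<Union>a\<in>R. \<Union>b\<in>S. filter_cong L F `` {a \<otimes>\<^bsub>L\<^esub> b}),
      one = F,
      tle = (\<lambda>R S. \<exists>a\<in>R. \<exists>b\<in>S. a \<preceq>\<^bsub>L\<^esub> b)\<rparr>"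


section \<open>Composition tomonoids\<close>

text \<open>Maps \<open>R \<rightarrow> R\<close> are represented by the extensional functions \<open>R \<rightarrow>\<^sub>E R\<close>, so that
  equality of sets of maps on \<open>R\<close> has its usual meaning.\<close>

definition composition_tomonoid ::
    "'a set \<Rightarrow> ('a \<Rightarrow> 'a \<Rightarrow> bool) \<Rightarrow> ('a \<Rightarrow> 'a) set \<Rightarrow> bool" where
  "composition_tomonoid R leq \<Phi> \<longleftrightarrow> totally_ordered R leq \<and>
     \<Phi> \<subseteq> R \<rightarrow>\<^sub>E R \<and> (\<forall>g\<in>\<Phi>. monotone_on R leq leq g) \<and>
     totally_ordered \<Phi> (\<lambda>g h. \<forall>x\<in>R. leq (g x) (h x)) \<and>
     (\<forall>g\<in>\<Phi>. \<forall>h\<in>\<Phi>. compose R g h \<in> \<Phi>) \<and> (\<lambda>x\<in>R. x) \<in> \<Phi>"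

text \<open>\<open>transport \<phi> R S g\<close> is \<open>\<phi> \<circ> g \<circ> \<phi>\<inverse> : S \<rightarrow> S\<close>, for \<open>g : R \<rightarrow> R\<close> and a bijection
  \<open>\<phi> : R \<rightarrow> S\<close>.\<close>

definition transport :: "('a \<Rightarrow> 'b) \<Rightarrow> 'a set \<Rightarrow> 'b set \<Rightarrow> ('a \<Rightarrow> 'a) \<Rightarrow> 'b \<Rightarrow> 'b" where
  "transport \<phi> R S g = (\<lambda>y\<in>S. \<phi> (g (inv_into R \<phi> y)))"

definition c_isos :: "'a set \<Rightarrow> ('a \<Rightarrow> 'a \<Rightarrow> bool) \<Rightarrow> ('a \<Rightarrow> 'a) set \<Rightarrow>
    'b set \<Rightarrow> ('b \<Rightarrow> 'b \<Rightarrow> bool) \<Rightarrow> ('b \<Rightarrow> 'b) set \<Rightarrow> ('a \<Rightarrow> 'b) set" where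
  "c_isos R leR \<Phi> S leS \<Psi> = {\<phi> \<in> order_isos R leR S leS. \<Psi> = transport \<phi> R S ` \<Phi>}"

definition lukasiewicz_maps :: "(real \<Rightarrow> real) set" where
  "lukasiewicz_maps = (\<lambda>t. \<lambda>x\<in>{0..1}. max (x + t - 1) 0) ` {0..1}"

definition product_maps :: "(real \<Rightarrow> real) set" where
  "product_maps = (\<lambda>t. \<lambda>x\<in>{0<..1}. t * x) ` {0<..1}"

definition reversed_product_maps :: "(real \<Rightarrow> real) set" where
  "reversed_product_maps = (\<lambda>t. \<lambda>x\<in>{0..<1}. max (x + t - 1) 0 / t) ` {0<..1}"

definition power_maps :: "(real \<Rightarrow> real) set" where
  "power_maps = (\<lambda>t. \<lambda>x\<in>{0<..<1}. x powr (1 / t)) ` {0<..1}"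

definition lukasiewicz_ct :: "'a set \<Rightarrow> ('a \<Rightarrow> 'a \<Rightarrow> bool) \<Rightarrow> ('a \<Rightarrow> 'a) set \<Rightarrow> bool" where
  "lukasiewicz_ct R leq \<Phi> \<longleftrightarrow> composition_tomonoid R leq \<Phi> \<and>
     c_isos R leq \<Phi> {0..1} (\<le>) lukasiewicz_maps \<noteq> {}"

definition product_ct :: "'a set \<Rightarrow> ('a \<Rightarrow> 'a \<Rightarrow> bool) \<Rightarrow> ('a \<Rightarrow> 'a) set \<Rightarrow> bool" where
  "product_ct R leq \<Phi> \<longleftrightarrow> composition_tomonoid R leq \<Phi> \<and>
     c_isos R leq \<Phi> {0<..1} (\<le>) product_maps \<noteq> {}"

definition reversed_product_ct :: "'a set \<Rightarrow> ('a \<Rightarrow> 'a \<Rightarrow> bool) \<Rightarrow> ('a \<Rightarrow> 'a) set \<Rightarrow> bool" where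
  "reversed_product_ct R leq \<Phi> \<longleftrightarrow> composition_tomonoid R leq \<Phi> \<and>
     c_isos R leq \<Phi> {0..<1} (\<le>) reversed_product_maps \<noteq> {}"

definition power_ct :: "'a set \<Rightarrow> ('a \<Rightarrow> 'a \<Rightarrow> bool) \<Rightarrow> ('a \<Rightarrow> 'a) set \<Rightarrow> bool" where
  "power_ct R leq \<Phi> \<longleftrightarrow> composition_tomonoid R leq \<Phi> \<and>
     c_isos R leq \<Phi> {0<..<1} (\<le>) power_maps \<noteq> {}"


section \<open>Translations of a class\<close>

definition translation :: "('a, 'm) tomonoid_scheme \<Rightarrow> 'a \<Rightarrow> 'a \<Rightarrow> 'a" where
  "translation L a = (\<lambda>x\<in>carrier L. a \<otimes>\<^bsub>L\<^esub> x)"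

definition rho :: "('a, 'm) tomonoid_scheme \<Rightarrow> 'a set \<Rightarrow> 'a \<Rightarrow> 'a \<Rightarrow> 'a" where
  "rho L R f = restrict (translation L f) R"

definition Lam :: "('a, 'm) tomonoid_scheme \<Rightarrow> 'a set \<Rightarrow> 'a set \<Rightarrow> ('a \<Rightarrow> 'a) set" where
  "Lam L F R = rho L R ` F"

end

theory Submission
  imports Defs
begin

text \<open>
  \<open>F\<close> carries real labels in \<open>[0,1]\<close> or \<open>(0,1]\<close>, and the maps in \<open>\<Lambda>\<^sup>R\<close> are labelled by the real
  parameter \<open>t\<close> of the canonical families. In each family composition of maps is, on parameters,
  the Lukasiewicz product or the product of reals, and larger parameters are detected by larger maps.
  Hence \<open>\<varrho>\<^sub>R\<close> becomes a surjective, monotone homomorphism \<open>T\<close> between the Lukasiewicz or product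
  structures on real intervals (\<open>translation_parameter\<close>). Written in the coordinates \<open>1 - a\<close>
  (Lukasiewicz) and \<open>- ln a\<close> (product), \<open>T\<close> is a monotone solution of Cauchy's functional equation
  on the non-negative reals, with sums cut off at \<open>1\<close> if the target is Lukasiewicz. Such a solution is
  \<open>x \<mapsto> \<alpha> x\<close>, cut off at \<open>1\<close> in the Lukasiewicz case (\<open>monotone_capped_additive_linear\<close>,
  \<open>monotone_additive_linear\<close>), and this gives the stated formulas. If \<open>F\<close> is Lukasiewicz, the least
  element of \<open>F\<close> is mapped to \<open>0\<close>, so that \<open>\<alpha> \<ge> 1\<close>.

  If \<open>F\<close> is Lukasiewicz, it has moreover to be shown that \<open>\<Lambda>\<^sup>R\<close> is Lukasiewicz. As \<open>F\<close> has a least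
  element, \<open>R\<close> contains its supremum \<open>s\<close>. Compatibility of the product with suprema implies that every
  element of \<open>R\<close> is of the form \<open>a \<odot> s\<close> with \<open>a \<in> F\<close> (\<open>elt_residual\<close>). For some \<open>z < 1\<close> the map
  \<open>a \<mapsto> a \<odot> s\<close> is injective on \<open>[z,1]\<close> and sends all of \<open>[0,z]\<close> to the least element of \<open>R\<close>
  (\<open>residual_elt_R_max\<close>). Thus \<open>R\<close> is a copy of \<open>[z,1]\<close> on which \<open>F\<close> acts by the Lukasiewicz
  product cut off at \<open>z\<close>, and rescaling \<open>[z,1]\<close> to \<open>[0,1]\<close> is the required c-isomorphism.
\<close>

section \<open>Cauchy's functional equation for monotone functions\<close>

lemma multiple_of_capped_additive:
  fixes d :: "real \<Rightarrow> real"
  assumes add: "\<And>x y. x \<ge> 0 \<Longrightarrow> y \<ge> 0 \<Longrightarrow> d (x + y) = min (d x + d y) 1"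
    and nonneg: "\<And>x. x \<ge> 0 \<Longrightarrow> d x \<ge> 0" and x: "x \<ge> 0" and n: "n \<ge> (1::nat)"
  shows "d (real n * x) = min (real n * d x) 1"
  using n
proof (induction n rule: dec_induct)
  case base
  have "d x \<le> 1"
  proof -
    have "d (x + 0) = min (d x + d 0) 1" using add[of x 0] x by simp
    then show ?thesis by simp
  qed
  then show ?case by simp
next
  case (step n)
  have "d (real (Suc n) * x) = d (real n * x + x)" by (simp add: algebra_simps)
  also have "\<dots> = min (d (real n * x) + d x) 1" using add[of "real n * x" x] x by simp
  also have "\<dots> = min (real (Suc n) * d x) 1"
    using step.IH nonneg[OF x] by (simp add: algebra_simps min_def)
  finally show ?case .
qed

text \<open>A monotone solution of the Cauchy equation in which sums are cut off at \<open>1\<close> is a linear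
  function cut off at \<open>1\<close>. That the value \<open>1 / 2\<close> is attained excludes the two constant solutions
  and a jump from \<open>0\<close> to \<open>1\<close>.\<close>

lemma monotone_capped_additive_linear:
  fixes d :: "real \<Rightarrow> real"
  assumes add: "\<And>x y. x \<ge> 0 \<Longrightarrow> y \<ge> 0 \<Longrightarrow> d (x + y) = min (d x + d y) 1"
    and nonneg: "\<And>x. x \<ge> 0 \<Longrightarrow> d x \<ge> 0"
    and mono: "\<And>x y. 0 \<le> x \<Longrightarrow> x \<le> y \<Longrightarrow> d x \<le> d y"
    and half: "x0 \<ge> 0" "d x0 = 1 / 2"
  obtains \<alpha> where "\<alpha> > 0" "\<And>x. x \<ge> 0 \<Longrightarrow> d x = min (\<alpha> * x) 1"
proof -
  have mult: "d (real n * x) = min (real n * d x) 1" if "x \<ge> 0" "n \<ge> 1" for n :: nat and x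
    using multiple_of_capped_additive[of d x n] add nonneg that by blast
  have x0: "x0 > 0"
  proof (rule ccontr)
    assume "\<not> x0 > 0"
    with half have "d 0 = 1 / 2" by simp
    with add[of 0 0] show False by simp
  qed
  have le1: "d x \<le> 1" if "x \<ge> 0" for x
    using mult[OF that, of 1] by simp
  \<comment> \<open>As \<open>d\<close> takes the uncapped value \<open>1/2\<close> at \<open>x0\<close>, its values at rational multiples of \<open>x0\<close>
    are determined; the others are then squeezed between them.\<close>
  have rat: "d (q * x0) = min (q / 2) 1" if q: "q \<in> \<rat>" "q > 0" for q
  proof -
    obtain k n where kn: "n \<noteq> 0" "\<bar>q\<bar> = real k / real n"
      using Rats_abs_nat_div_natE[OF q(1)] by metis
    with q have qk: "q = real k / real n" and k: "k \<ge> 1" and n: "n \<ge> 1"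
      by (cases k; cases n; auto)+
    have "d (real n * (x0 / n)) = min (real n * d (x0 / n)) 1" using mult[of "x0 / n" n] x0 n by simp
    with half n have "min (real n * d (x0 / n)) 1 = 1 / 2" by simp
    then have "real n * d (x0 / n) = 1 / 2" by (simp add: min_def split: if_splits)
    then have "d (x0 / n) = 1 / (2 * n)" using n by (simp add: field_simps)
    moreover have "d (real k * (x0 / n)) = min (real k * d (x0 / n)) 1"
      using mult[of "x0 / n" k] x0 k by simp
    ultimately show ?thesis by (simp add: qk field_simps)
  qed
  have "d x = min (1 / (2 * x0) * x) 1" if x: "x \<ge> 0" for x
  proof (rule antisym)
    define y where "y = x / x0"
    have xy: "x = y * x0" and y: "y \<ge> 0" using x x0 by (auto simp: y_def)
    have eq: "1 / (2 * x0) * x = y / 2" using x0 by (simp add: xy)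
    show "d x \<le> min (1 / (2 * x0) * x) 1"
    proof (rule ccontr)
      assume "\<not> ?thesis"
      with le1[OF x] have "y < 2 * d x" unfolding eq by (auto simp: min_def split: if_splits)
      then obtain q where q: "q \<in> \<rat>" "y < q" "q < 2 * d x" using Rats_dense_in_real by blast
      have "d x \<le> d (q * x0)" using x x0 q by (intro mono) (auto simp: xy)
      also have "\<dots> \<le> q / 2" using rat[of q] q y by simp
      finally show False using q by simp
    qed
    show "min (1 / (2 * x0) * x) 1 \<le> d x"
    proof (rule ccontr)
      assume "\<not> ?thesis"
      then have dx: "d x < y / 2" "d x < 1" unfolding eq by auto
      then obtain q where q: "q \<in> \<rat>" "2 * d x < q" "q < y"
        using Rats_dense_in_real[of "2 * d x" y] by auto
      have q0: "q > 0" using q nonneg[OF x] by linarith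
      have "min (q / 2) 1 = d (q * x0)" using rat[OF q(1) q0] by simp
      also have "\<dots> \<le> d x" using q q0 x0 by (intro mono) (auto simp: xy)
      finally show False using q dx by (simp add: min_def split: if_splits)
    qed
  qed
  with that[of "1 / (2 * x0)"] x0 show thesis by simp
qed

lemma monotone_additive_linear:
  fixes d :: "real \<Rightarrow> real"
  assumes add: "\<And>x y. x \<ge> 0 \<Longrightarrow> y \<ge> 0 \<Longrightarrow> d (x + y) = d x + d y"
    and nonneg: "\<And>x. x \<ge> 0 \<Longrightarrow> d x \<ge> 0"
    and mono: "\<And>x y. 0 \<le> x \<Longrightarrow> x \<le> y \<Longrightarrow> d x \<le> d y"
    and half: "x0 \<ge> 0" "d x0 = 1 / 2"
  obtains \<alpha> where "\<alpha> > 0" "\<And>x. x \<ge> 0 \<Longrightarrow> d x = \<alpha> * x"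
proof -
  obtain \<alpha> where \<alpha>: "\<alpha> > 0" "\<And>x. x \<ge> 0 \<Longrightarrow> min (d x) 1 = min (\<alpha> * x) 1"
  proof (rule monotone_capped_additive_linear[of "\<lambda>x. min (d x) 1" x0])
    show "min (d (x + y)) 1 = min (min (d x) 1 + min (d y) 1) 1" if "x \<ge> 0" "y \<ge> 0" for x y
      using add[OF that] nonneg[OF that(1)] nonneg[OF that(2)] by (auto simp: min_def)
    show "min (d x) 1 \<ge> 0" if "x \<ge> 0" for x using nonneg[OF that] by simp
    show "min (d x) 1 \<le> min (d y) 1" if "0 \<le> x" "x \<le> y" for x y
      using mono[OF that] by (auto simp: min_def)
  qed (use half in auto)
  have mult: "d (real n * x) = real n * d x" if "n \<ge> 1" "x \<ge> 0" for n :: nat and x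
    using that(1)
  proof (induction n rule: dec_induct)
    case (step n)
    have "d (real (Suc n) * x) = d (real n * x + x)" by (simp add: algebra_simps)
    then show ?case using add[of "real n * x" x] that(2) step.IH by (simp add: algebra_simps)
  qed simp
  have "d x = \<alpha> * x" if x: "x \<ge> 0" for x
  proof -
    \<comment> \<open>Divide \<open>x\<close> by a natural number large enough for the cap to play no role.\<close>
    obtain n :: nat where n: "real n > max (\<alpha> * x) 1" using reals_Archimedean2 by blast
    then have n1: "n \<ge> 1" by simp
    have "min (d (x / n)) 1 = min (\<alpha> * (x / n)) 1" using \<alpha>(2) x by simp
    moreover have "\<alpha> * (x / n) < 1" using n n1 by (simp add: field_simps)
    ultimately have "d (x / n) = \<alpha> * (x / n)" by (simp add: min_def split: if_splits)
    then show ?thesis using mult[OF n1, of "x / n"] x n1 by simp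
  qed
  with \<alpha>(1) that show thesis by blast
qed

section \<open>Parameter homomorphisms\<close>

lemma lukasiewicz_to_lukasiewicz:
  fixes T :: "real \<Rightarrow> real"
  assumes onto: "T ` {0..1} = {0..1}"
    and mono: "\<And>a b. a \<in> {0..1} \<Longrightarrow> b \<in> {0..1} \<Longrightarrow> a \<le> b \<Longrightarrow> T a \<le> T b"
    and hom: "\<And>a b. a \<in> {0..1} \<Longrightarrow> b \<in> {0..1} \<Longrightarrow> T (max (a + b - 1) 0) = max (T a + T b - 1) 0"
  obtains \<alpha> where "\<alpha> \<ge> 1" "\<And>a. a \<in> {0..1} \<Longrightarrow> T a = max (1 + \<alpha> * (a - 1)) 0"
proof -
  have T01: "T a \<in> {0..1}" if "a \<in> {0..1}" for a using onto that by blast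
  define d where "d x = 1 - T (max (1 - x) 0)" for x
  have "1 / 2 \<in> T ` {0..1}" "0 \<in> T ` {0..1}" unfolding onto by simp_all
  then obtain a0 b0 where a0: "a0 \<in> {0..1}" "T a0 = 1 / 2" and b0: "b0 \<in> {0..1}" "T b0 = 0"
    by force
  obtain \<alpha> where \<alpha>: "\<alpha> > 0" "\<And>x. x \<ge> 0 \<Longrightarrow> d x = min (\<alpha> * x) 1"
  proof (rule monotone_capped_additive_linear[of d "1 - a0"])
    show "d (x + y) = min (d x + d y) 1" if "x \<ge> 0" "y \<ge> 0" for x y
    proof -
      have "max (max (1 - x) 0 + max (1 - y) 0 - 1) 0 = max (1 - (x + y)) 0"
        using that by (auto simp: max_def)
      with hom[of "max (1 - x) 0" "max (1 - y) 0"] that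
      have "T (max (1 - (x + y)) 0) = max (T (max (1 - x) 0) + T (max (1 - y) 0) - 1) 0" by simp
      then show ?thesis unfolding d_def by linarith
    qed
    show "d x \<ge> 0" if "x \<ge> 0" for x using T01[of "max (1 - x) 0"] that by (auto simp: d_def)
    show "d x \<le> d y" if "0 \<le> x" "x \<le> y" for x y
      using mono[of "max (1 - y) 0" "max (1 - x) 0"] that by (auto simp: d_def)
    show "d (1 - a0) = 1 / 2" using a0 by (auto simp: d_def)
  qed (use a0 in auto)
  have T: "T a = max (1 + \<alpha> * (a - 1)) 0" if "a \<in> {0..1}" for a
  proof -
    have "1 - T a = min (\<alpha> * (1 - a)) 1" using \<alpha>(2)[of "1 - a"] that by (auto simp: d_def)
    moreover have "\<alpha> * (a - 1) = - (\<alpha> * (1 - a))" by (simp add: algebra_simps)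
    ultimately show ?thesis by linarith
  qed
  have "T 0 = 0" using mono[of 0 b0] b0 T01[of 0] by auto
  with T[of 0] have "\<alpha> \<ge> 1" by (auto simp: max_def split: if_splits)
  with T that show thesis by blast
qed

lemma product_to_lukasiewicz:
  fixes T :: "real \<Rightarrow> real"
  assumes onto: "T ` {0<..1} = {0..1}"
    and mono: "\<And>a b. a \<in> {0<..1} \<Longrightarrow> b \<in> {0<..1} \<Longrightarrow> a \<le> b \<Longrightarrow> T a \<le> T b"
    and hom: "\<And>a b. a \<in> {0<..1} \<Longrightarrow> b \<in> {0<..1} \<Longrightarrow> T (a * b) = max (T a + T b - 1) 0"
  obtains \<alpha> where "\<alpha> > 0" "\<And>a. a \<in> {0<..1} \<Longrightarrow> T a = max (1 + \<alpha> * ln a) 0"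
proof -
  have T01: "T a \<in> {0..1}" if "a \<in> {0<..1}" for a using onto that by blast
  define d where "d x = 1 - T (exp (- x))" for x
  have "1 / 2 \<in> T ` {0<..1}" unfolding onto by simp
  then obtain a0 where a0: "a0 \<in> {0<..1}" "T a0 = 1 / 2" by force
  obtain \<alpha> where \<alpha>: "\<alpha> > 0" "\<And>x. x \<ge> 0 \<Longrightarrow> d x = min (\<alpha> * x) 1"
  proof (rule monotone_capped_additive_linear[of d "- ln a0"])
    show "d (x + y) = min (d x + d y) 1" if "x \<ge> 0" "y \<ge> 0" for x y
    proof -
      have "T (exp (- (x + y))) = max (T (exp (- x)) + T (exp (- y)) - 1) 0"
        using hom[of "exp (- x)" "exp (- y)"] that by (simp flip: exp_add)
      then show ?thesis unfolding d_def by linarith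
    qed
    show "d x \<ge> 0" if "x \<ge> 0" for x using T01[of "exp (- x)"] that by (auto simp: d_def)
    show "d x \<le> d y" if "0 \<le> x" "x \<le> y" for x y
      using mono[of "exp (- y)" "exp (- x)"] that by (auto simp: d_def)
    show "d (- ln a0) = 1 / 2" using a0 by (auto simp: d_def)
  qed (use a0 in auto)
  have "T a = max (1 + \<alpha> * ln a) 0" if "a \<in> {0<..1}" for a
  proof -
    have "1 - T a = min (\<alpha> * (- ln a)) 1" using \<alpha>(2)[of "- ln a"] that by (auto simp: d_def)
    then show ?thesis by simp
  qed
  with \<alpha>(1) that show thesis by blast
qed

lemma product_to_product:
  fixes T :: "real \<Rightarrow> real"
  assumes onto: "T ` {0<..1} = {0<..1}"
    and mono: "\<And>a b. a \<in> {0<..1} \<Longrightarrow> b \<in> {0<..1} \<Longrightarrow> a \<le> b \<Longrightarrow> T a \<le> T b"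
    and hom: "\<And>a b. a \<in> {0<..1} \<Longrightarrow> b \<in> {0<..1} \<Longrightarrow> T (a * b) = T a * T b"
  obtains \<alpha> where "\<alpha> > 0" "\<And>a. a \<in> {0<..1} \<Longrightarrow> T a = a powr \<alpha>"
proof -
  have T01: "T a \<in> {0<..1}" if "a \<in> {0<..1}" for a using onto that by blast
  define d where "d x = - ln (T (exp (- x)))" for x
  have "exp (- (1 / 2)) \<in> T ` {0<..1}" unfolding onto by simp
  then obtain a0 where a0: "a0 \<in> {0<..1}" "T a0 = exp (- (1 / 2))" by force
  obtain \<alpha> where \<alpha>: "\<alpha> > 0" "\<And>x. x \<ge> 0 \<Longrightarrow> d x = \<alpha> * x"
  proof (rule monotone_additive_linear[of d "- ln a0"])
    show "d (x + y) = d x + d y" if "x \<ge> 0" "y \<ge> 0" for x y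
      using hom[of "exp (- x)" "exp (- y)"] that T01[of "exp (- x)"] T01[of "exp (- y)"]
      by (simp add: d_def ln_mult flip: exp_add)
    show "d x \<ge> 0" if "x \<ge> 0" for x using T01[of "exp (- x)"] that by (auto simp: d_def)
    show "d x \<le> d y" if "0 \<le> x" "x \<le> y" for x y
      using mono[of "exp (- y)" "exp (- x)"] that T01[of "exp (- x)"] T01[of "exp (- y)"]
      by (auto simp: d_def)
    show "d (- ln a0) = 1 / 2" using a0 by (auto simp: d_def)
  qed (use a0 in auto)
  have "T a = a powr \<alpha>" if a: "a \<in> {0<..1}" for a
  proof -
    have "ln (T a) = \<alpha> * ln a" using \<alpha>(2)[of "- ln a"] a by (auto simp: d_def)
    then have "exp (ln (T a)) = a powr \<alpha>" using a by (simp add: powr_def)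
    then show ?thesis using T01[OF a] by simp
  qed
  with \<alpha>(1) that show thesis by blast
qed

section \<open>Classes of a filter\<close>

text \<open>A q.n.c. tomonoid \<open>L\<close>, a filter \<open>F\<close> of \<open>L\<close>, and one of the classes of \<open>F\<close>.\<close>

locale filter_class = qnc_tomonoid L for L :: "('a, 'm) tomonoid_scheme" (structure) +
  fixes F R :: "'a set"
  assumes filter: "tomonoid_filter L F"
    and R_class: "R \<in> carrier (filter_quotient L F)"
begin

lemma tle_refl: "x \<in> carrier L \<Longrightarrow> x \<preceq> x"
  using total_order by (auto simp: totally_ordered_def reflp_on_def)

lemma tle_trans:
  "x \<preceq> y \<Longrightarrow> y \<preceq> z \<Longrightarrow> x \<in> carrier L \<Longrightarrow> y \<in> carrier L \<Longrightarrow> z \<in> carrier L \<Longrightarrow> x \<preceq> z"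
  using total_order unfolding totally_ordered_def transp_on_def by blast

lemma tle_antisym: "x \<preceq> y \<Longrightarrow> y \<preceq> x \<Longrightarrow> x \<in> carrier L \<Longrightarrow> y \<in> carrier L \<Longrightarrow> x = y"
  using total_order unfolding totally_ordered_def antisymp_on_def by blast

lemma tle_total: "x \<in> carrier L \<Longrightarrow> y \<in> carrier L \<Longrightarrow> x \<preceq> y \<or> y \<preceq> x"
  using total_order tle_refl unfolding totally_ordered_def totalp_on_def by metis

lemma F_carrier: "f \<in> F \<Longrightarrow> f \<in> carrier L"
  and F_one: "\<one> \<in> F"
  and F_mult: "f \<in> F \<Longrightarrow> g \<in> F \<Longrightarrow> f \<otimes> g \<in> F"
  and F_up: "f \<in> F \<Longrightarrow> b \<in> carrier L \<Longrightarrow> f \<preceq> b \<Longrightarrow> b \<in> F"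
  using filter unfolding tomonoid_filter_def by blast+

lemma mult_left_le_mono:
  "a \<preceq> b \<Longrightarrow> a \<in> carrier L \<Longrightarrow> b \<in> carrier L \<Longrightarrow> x \<in> carrier L \<Longrightarrow> a \<otimes> x \<preceq> b \<otimes> x"
  and mult_right_le_mono:
  "a \<preceq> b \<Longrightarrow> a \<in> carrier L \<Longrightarrow> b \<in> carrier L \<Longrightarrow> x \<in> carrier L \<Longrightarrow> x \<otimes> a \<preceq> x \<otimes> b"
  by (simp_all add: mult_le_mono tle_refl)

lemma mult_le_self: "f \<in> carrier L \<Longrightarrow> x \<in> carrier L \<Longrightarrow> f \<otimes> x \<preceq> x"
  using mult_left_le_mono[of f \<one> x] negative[of f] by simp

text \<open>Since \<open>\<one>\<close> belongs to \<open>F\<close>, the case distinction in the definition of the congruence can be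
  replaced by a symmetric condition.\<close>

lemma filter_cong_iff:
  "(a, b) \<in> filter_cong L F \<longleftrightarrow> a \<in> carrier L \<and> b \<in> carrier L \<and>
     (\<exists>f\<in>F. f \<otimes> a \<preceq> b) \<and> (\<exists>f\<in>F. f \<otimes> b \<preceq> a)"
proof -
  have *: "\<exists>f\<in>F. f \<otimes> x \<preceq> y" if "x \<preceq> y" "x \<in> carrier L" for x y
    by (rule bexI[of _ \<one>]) (use that F_one in simp_all)
  have comm: "(\<exists>f\<in>F. x \<otimes> f \<preceq> y) \<longleftrightarrow> (\<exists>f\<in>F. f \<otimes> x \<preceq> y)" if "x \<in> carrier L" for x y
    using that by (intro bex_cong refl) (simp add: m_comm F_carrier)
  show ?thesis
  proof (cases "a \<in> carrier L \<and> b \<in> carrier L")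
    case True
    then show ?thesis
      using * [of a b] * [of b a] * [of a a] tle_total[of a b] tle_refl[of a]
      by (simp add: filter_cong_def comm) blast
  next
    case False
    then show ?thesis by (auto simp: filter_cong_def)
  qed
qed

lemma filter_cong_trans:
  assumes "(a, b) \<in> filter_cong L F" "(b, c) \<in> filter_cong L F"
  shows "(a, c) \<in> filter_cong L F"
proof -
  have *: "\<exists>h\<in>F. h \<otimes> x \<preceq> z"
    if "f \<in> F" "g \<in> F" "f \<otimes> x \<preceq> y" "g \<otimes> y \<preceq> z"
      "x \<in> carrier L" "y \<in> carrier L" "z \<in> carrier L" for f g x y z
  proof (intro bexI[of _ "g \<otimes> f"])
    have "g \<otimes> (f \<otimes> x) \<preceq> g \<otimes> y" using that by (intro mult_right_le_mono) (auto simp: F_carrier)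
    then show "(g \<otimes> f) \<otimes> x \<preceq> z"
      using that tle_trans[of "g \<otimes> (f \<otimes> x)" "g \<otimes> y" z] by (simp add: F_carrier m_assoc)
  qed (simp add: that F_mult)
  show ?thesis using assms unfolding filter_cong_iff using * by blast
qed

lemma filter_cong_sym: "(a, b) \<in> filter_cong L F \<Longrightarrow> (b, a) \<in> filter_cong L F"
  by (simp add: filter_cong_iff)

lemma R_eq: obtains a where "a \<in> carrier L" "R = filter_cong L F `` {a}"
  using R_class unfolding filter_quotient_def by (auto elim: quotientE)

lemma R_cong: "x \<in> R \<Longrightarrow> y \<in> R \<Longrightarrow> (x, y) \<in> filter_cong L F"
proof -
  obtain a where "R = filter_cong L F `` {a}" by (rule R_eq)
  moreover assume "x \<in> R" "y \<in> R"
  ultimately show ?thesis using filter_cong_trans filter_cong_sym by blast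
qed

lemma R_closed: "x \<in> R \<Longrightarrow> (x, y) \<in> filter_cong L F \<Longrightarrow> y \<in> R"
proof -
  obtain a where "R = filter_cong L F `` {a}" by (rule R_eq)
  moreover assume "x \<in> R" "(x, y) \<in> filter_cong L F"
  ultimately show ?thesis using filter_cong_trans by blast
qed

lemma R_carrier: "x \<in> R \<Longrightarrow> x \<in> carrier L"
  using R_cong[of x x] by (simp add: filter_cong_iff)

lemma R_nonempty: "R \<noteq> {}"
proof -
  obtain a where "a \<in> carrier L" "R = filter_cong L F `` {a}" by (rule R_eq)
  moreover have "(a, a) \<in> filter_cong L F" if "a \<in> carrier L" for a
    using that by (simp add: filter_cong_def)
  ultimately show ?thesis by blast
qed

lemma R_below: "x \<in> R \<Longrightarrow> y \<in> R \<Longrightarrow> \<exists>f\<in>F. f \<otimes> x \<preceq> y"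
  using R_cong[of x y] by (simp add: filter_cong_iff)

lemma R_intro:
  assumes "x \<in> R" "y \<in> carrier L" "f \<in> F" "f \<otimes> x \<preceq> y" "g \<in> F" "g \<otimes> y \<preceq> x"
  shows "y \<in> R"
proof (rule R_closed[of x])
  show "(x, y) \<in> filter_cong L F" unfolding filter_cong_iff using assms R_carrier by blast
qed (rule assms(1))

lemma R_mult: "f \<in> F \<Longrightarrow> r \<in> R \<Longrightarrow> f \<otimes> r \<in> R"
  by (rule R_intro[of r _ f \<one>]) (simp_all add: R_carrier F_carrier F_one mult_le_self tle_refl)

lemma rho_apply: "f \<in> F \<Longrightarrow> r \<in> R \<Longrightarrow> rho L R f r = f \<otimes> r"
  by (simp add: rho_def translation_def R_carrier)

lemma composition_tomonoid_Lam: "composition_tomonoid R (\<preceq>) (Lam L F R)"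
proof -
  have Rord: "totally_ordered R (\<preceq>)"
  proof -
    have "R \<subseteq> carrier L" using R_carrier by blast
    then show ?thesis
      using total_order unfolding totally_ordered_def
      by (elim conjE, intro conjI)
        (erule (1) reflp_on_subset transp_on_subset antisymp_on_subset totalp_on_subset)+
  qed
  have sub: "Lam L F R \<subseteq> R \<rightarrow>\<^sub>E R"
    using R_mult by (auto simp: Lam_def rho_def translation_def R_carrier)
  have mono: "monotone_on R (\<preceq>) (\<preceq>) g" if "g \<in> Lam L F R" for g
    using that by (auto simp: Lam_def monotone_on_def rho_apply R_carrier F_carrier
        intro!: mult_right_le_mono)
  have tot: "totally_ordered (Lam L F R) (\<lambda>g h. \<forall>x\<in>R. g x \<preceq> h x)"
    unfolding totally_ordered_def
  proof (intro conjI)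
    show "reflp_on (Lam L F R) (\<lambda>g h. \<forall>x\<in>R. g x \<preceq> h x)"
      using sub by (auto simp: reflp_on_def intro!: tle_refl R_carrier)
    show "transp_on (Lam L F R) (\<lambda>g h. \<forall>x\<in>R. g x \<preceq> h x)"
      unfolding transp_on_def
    proof (intro ballI impI)
      fix f g h x
      assume *: "f \<in> Lam L F R" "g \<in> Lam L F R" "h \<in> Lam L F R"
        "\<forall>x\<in>R. f x \<preceq> g x" "\<forall>x\<in>R. g x \<preceq> h x" and x: "x \<in> R"
      have "f x \<in> carrier L" "g x \<in> carrier L" "h x \<in> carrier L"
        using * sub x R_carrier by blast+
      then show "f x \<preceq> h x" using * x tle_trans by blast
    qed
    show "antisymp_on (Lam L F R) (\<lambda>g h. \<forall>x\<in>R. g x \<preceq> h x)"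
    proof (rule antisymp_onI)
      fix g h assume *: "g \<in> Lam L F R" "h \<in> Lam L F R"
        "\<forall>x\<in>R. g x \<preceq> h x" "\<forall>x\<in>R. h x \<preceq> g x"
      have "g \<in> R \<rightarrow>\<^sub>E R" "h \<in> R \<rightarrow>\<^sub>E R" using sub * by auto
      then show "g = h" by (rule PiE_ext) (use * sub R_carrier in \<open>blast intro: tle_antisym\<close>)
    qed
    show "totalp_on (Lam L F R) (\<lambda>g h. \<forall>x\<in>R. g x \<preceq> h x)"
    proof (rule totalp_onI)
      fix g h assume "g \<in> Lam L F R" "h \<in> Lam L F R"
      then obtain a b where ab: "a \<in> F" "b \<in> F" "g = rho L R a" "h = rho L R b"
        by (auto simp: Lam_def)
      have "a \<preceq> b \<or> b \<preceq> a" using ab tle_total F_carrier by blast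
      then show "(\<forall>x\<in>R. g x \<preceq> h x) \<or> (\<forall>x\<in>R. h x \<preceq> g x)"
        using ab by (auto simp: rho_apply F_carrier R_carrier intro!: mult_left_le_mono)
    qed
  qed
  have comp: "compose R g h \<in> Lam L F R" if gh: "g \<in> Lam L F R" "h \<in> Lam L F R" for g h
  proof -
    obtain a b where ab: "a \<in> F" "b \<in> F" "g = rho L R a" "h = rho L R b"
      using gh by (auto simp: Lam_def)
    have "compose R g h = rho L R (a \<otimes> b)"
    proof (rule extensionalityI[of _ R])
      show "compose R g h x = rho L R (a \<otimes> b) x" if "x \<in> R" for x
        using ab that
        by (simp add: compose_eq rho_apply R_mult F_mult) (simp add: m_assoc F_carrier R_carrier)
    qed (simp_all add: rho_def)
    then show ?thesis using F_mult ab by (auto simp: Lam_def)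
  qed
  have "(\<lambda>x\<in>R. x) = rho L R \<one>"
    by (rule extensionalityI[of _ R]) (simp_all add: rho_apply F_one R_carrier, simp add: rho_def)
  then have "(\<lambda>x\<in>R. x) \<in> Lam L F R" using F_one by (auto simp: Lam_def)
  with Rord sub mono tot comp show ?thesis by (simp add: composition_tomonoid_def)
qed

text \<open>Let \<open>\<iota>\<close> label the elements of \<open>F\<close> by a tomonoid \<open>M\<close> of reals in their usual order, and let
  \<open>\<phi>\<close> transport the translations of \<open>R\<close> to a family \<open>g\<close> of maps, parametrised by \<open>D\<close>, such that
  composition of maps corresponds to the operation \<open>mul\<close> on parameters. If the pointwise order
  determines the order of the parameters, then \<open>\<varrho>\<^sub>R\<close> amounts to a surjective monotone homomorphism
  from \<open>M\<close> to \<open>D\<close>.\<close>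

lemma translation_parameter:
  fixes M :: "real tomonoid" and S :: "real set" and D :: "real set"
    and g :: "real \<Rightarrow> real \<Rightarrow> real"
  assumes \<iota>: "\<iota> \<in> tomonoid_isos (L\<lparr>carrier := F\<rparr>) M" and M: "tle M = (\<le>)"
    and \<phi>: "\<phi> \<in> c_isos R (\<preceq>) (Lam L F R) S (\<le>) ((\<lambda>t. \<lambda>x\<in>S. g t x) ` D)"
    and mul: "\<And>s t. s \<in> D \<Longrightarrow> t \<in> D \<Longrightarrow> mul s t \<in> D"
    and comp: "\<And>s t x. s \<in> D \<Longrightarrow> t \<in> D \<Longrightarrow> x \<in> S \<Longrightarrow> g s (g t x) = g (mul s t) x"
    and ord: "\<And>s t. s \<in> D \<Longrightarrow> t \<in> D \<Longrightarrow> (\<And>x. x \<in> S \<Longrightarrow> g s x \<le> g t x) \<Longrightarrow> s \<le> t"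
  obtains T where "T ` carrier M = D"
    "\<And>a b. a \<in> carrier M \<Longrightarrow> b \<in> carrier M \<Longrightarrow> a \<le> b \<Longrightarrow> T a \<le> T b"
    "\<And>a b. a \<in> carrier M \<Longrightarrow> b \<in> carrier M \<Longrightarrow> T (a \<otimes>\<^bsub>M\<^esub> b) = mul (T a) (T b)"
    "\<And>f. f \<in> F \<Longrightarrow> \<iota> f \<in> carrier M \<and> T (\<iota> f) \<in> D \<and>
       transport \<phi> R S (rho L R f) = (\<lambda>x\<in>S. g (T (\<iota> f)) x)"
proof -
  have bij\<iota>: "bij_betw \<iota> F (carrier M)"
    and hom\<iota>: "\<And>a b. a \<in> F \<Longrightarrow> b \<in> F \<Longrightarrow> \<iota> (a \<otimes> b) = \<iota> a \<otimes>\<^bsub>M\<^esub> \<iota> b"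
    and le\<iota>: "\<And>a b. a \<in> F \<Longrightarrow> b \<in> F \<Longrightarrow> a \<preceq> b \<longleftrightarrow> \<iota> a \<le> \<iota> b"
    using \<iota> by (auto simp: tomonoid_isos_def iso_def hom_def M)
  have bij\<phi>: "bij_betw \<phi> R S"
    and le\<phi>: "\<And>x y. x \<in> R \<Longrightarrow> y \<in> R \<Longrightarrow> x \<preceq> y \<longleftrightarrow> \<phi> x \<le> \<phi> y"
    and img: "(\<lambda>t. \<lambda>x\<in>S. g t x) ` D = transport \<phi> R S ` Lam L F R"
    using \<phi> by (auto simp: c_isos_def order_isos_def)
  have "\<forall>f\<in>F. \<exists>t\<in>D. transport \<phi> R S (rho L R f) = (\<lambda>x\<in>S. g t x)"
  proof
    fix f assume "f \<in> F"
    then have "transport \<phi> R S (rho L R f) \<in> (\<lambda>t. \<lambda>x\<in>S. g t x) ` D"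
      unfolding img Lam_def by blast
    then show "\<exists>t\<in>D. transport \<phi> R S (rho L R f) = (\<lambda>x\<in>S. g t x)" by blast
  qed
  then obtain \<tau> where \<tau>: "\<And>f. f \<in> F \<Longrightarrow> \<tau> f \<in> D"
    "\<And>f. f \<in> F \<Longrightarrow> transport \<phi> R S (rho L R f) = (\<lambda>x\<in>S. g (\<tau> f) x)"
    by metis
  have act: "\<phi> (f \<otimes> r) = g (\<tau> f) (\<phi> r)" if "f \<in> F" "r \<in> R" for f r
  proof -
    have "\<phi> r \<in> S" using bij\<phi> that bij_betwE by blast
    moreover have "inv_into R \<phi> (\<phi> r) = r"
      using bij\<phi> that by (simp add: bij_betw_def)
    ultimately show ?thesis
      using fun_cong[OF \<tau>(2)[OF that(1)], of "\<phi> r"] that by (simp add: transport_def rho_apply)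
  qed
  have S_cases: "\<exists>r\<in>R. x = \<phi> r" if "x \<in> S" for x
    using bij\<phi> that by (auto simp: bij_betw_def)
  have parameter_eqI: "s = t"
    if "s \<in> D" "t \<in> D" "\<And>x. x \<in> S \<Longrightarrow> g s x = g t x" for s t
    using ord[OF that(1,2)] ord[OF that(2,1)] that(3) by (metis order_antisym order_refl)
  have mono: "\<tau> f \<le> \<tau> h" if fh: "f \<in> F" "h \<in> F" "f \<preceq> h" for f h
  proof (rule ord)
    fix x assume "x \<in> S"
    then obtain r where r: "r \<in> R" "x = \<phi> r" using S_cases by blast
    have "f \<otimes> r \<preceq> h \<otimes> r" using fh r by (intro mult_left_le_mono) (auto simp: F_carrier R_carrier)
    then have "\<phi> (f \<otimes> r) \<le> \<phi> (h \<otimes> r)" using le\<phi> R_mult fh r by blast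
    then show "g (\<tau> f) x \<le> g (\<tau> h) x" using act fh r by simp
  qed (use \<tau> fh in auto)
  have hom: "\<tau> (f \<otimes> h) = mul (\<tau> f) (\<tau> h)" if fh: "f \<in> F" "h \<in> F" for f h
  proof -
    have eq: "g (\<tau> (f \<otimes> h)) x = g (mul (\<tau> f) (\<tau> h)) x" if x: "x \<in> S" for x
    proof -
      obtain r where r: "r \<in> R" "x = \<phi> r" using S_cases x by blast
      have "g (\<tau> (f \<otimes> h)) x = \<phi> (f \<otimes> (h \<otimes> r))"
        using r fh act[of "f \<otimes> h" r] by (simp add: F_mult m_assoc F_carrier R_carrier)
      also have "\<dots> = g (\<tau> f) (g (\<tau> h) x)" using r fh act R_mult by simp
      finally show ?thesis using comp \<tau>(1) fh x by simp
    qed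
    show ?thesis by (rule parameter_eqI) (use eq \<tau>(1) fh mul F_mult in auto)
  qed
  have onto: "\<exists>f\<in>F. \<tau> f = t" if t: "t \<in> D" for t
  proof -
    have "(\<lambda>x\<in>S. g t x) \<in> transport \<phi> R S ` Lam L F R" using img t by blast
    then obtain f where f: "f \<in> F" "(\<lambda>x\<in>S. g t x) = (\<lambda>x\<in>S. g (\<tau> f) x)"
      using \<tau>(2) by (auto simp: Lam_def)
    have "\<tau> f = t"
    proof (rule parameter_eqI)
      show "g (\<tau> f) x = g t x" if "x \<in> S" for x using fun_cong[OF f(2), of x] that by simp
    qed (use \<tau>(1) f t in auto)
    with f show ?thesis by blast
  qed
  define \<kappa> where "\<kappa> = inv_into F \<iota>"
  have \<kappa>\<iota>: "\<kappa> (\<iota> f) = f" if "f \<in> F" for f using that bij\<iota> by (simp add: \<kappa>_def bij_betw_def)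
  have \<iota>M: "\<iota> f \<in> carrier M" if "f \<in> F" for f using that bij\<iota> bij_betwE by blast
  have M_cases: "\<exists>f\<in>F. a = \<iota> f" if "a \<in> carrier M" for a
    using bij\<iota> that by (auto simp: bij_betw_def)
  show thesis
  proof (rule that[of "\<lambda>a. \<tau> (\<kappa> a)"])
    show "(\<lambda>a. \<tau> (\<kappa> a)) ` carrier M = D"
      using onto M_cases \<tau>(1) \<iota>M \<kappa>\<iota> by (force simp: image_iff)
    show "\<tau> (\<kappa> a) \<le> \<tau> (\<kappa> b)" if "a \<in> carrier M" "b \<in> carrier M" "a \<le> b" for a b
      using M_cases[OF that(1)] M_cases[OF that(2)] that(3) mono le\<iota> by (auto simp: \<kappa>\<iota>)
    show "\<tau> (\<kappa> (a \<otimes>\<^bsub>M\<^esub> b)) = mul (\<tau> (\<kappa> a)) (\<tau> (\<kappa> b))"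
      if "a \<in> carrier M" "b \<in> carrier M" for a b
      using M_cases[OF that(1)] M_cases[OF that(2)]
      by (auto simp: \<kappa>\<iota> F_mult hom simp flip: hom\<iota>)
    show "\<iota> f \<in> carrier M \<and> \<tau> (\<kappa> (\<iota> f)) \<in> D \<and>
        transport \<phi> R S (rho L R f) = (\<lambda>x\<in>S. g (\<tau> (\<kappa> (\<iota> f))) x)" if "f \<in> F" for f
      unfolding \<kappa>\<iota>[OF that] using \<tau>[OF that] \<iota>M[OF that] by (intro conjI)
  qed
qed

end

section \<open>Classes of a Lukasiewicz filter\<close>

text \<open>A non-singleton class of a filter \<open>F\<close> that is identified with \<open>[0,1]\<close> through \<open>\<iota>\<close>.\<close>

locale lukasiewicz_filter_class = filter_class +
  fixes \<iota> :: "'a \<Rightarrow> real"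
  assumes \<iota>_iso: "\<iota> \<in> tomonoid_isos (L\<lparr>carrier := F\<rparr>) lukasiewicz_unit"
    and R_not_singleton: "\<not> is_singleton R"
begin

text \<open>\<open>elt a\<close> is the element of \<open>F\<close> that is identified with \<open>a \<in> [0,1]\<close>.\<close>

definition elt :: "real \<Rightarrow> 'a" where
  "elt = inv_into F \<iota>"

lemma \<iota>_bij: "bij_betw \<iota> F {0..1}"
  and \<iota>_mult: "a \<in> F \<Longrightarrow> b \<in> F \<Longrightarrow> \<iota> (a \<otimes> b) = max (\<iota> a + \<iota> b - 1) 0"
  and \<iota>_one: "\<iota> \<one> = 1"
  and \<iota>_le: "a \<in> F \<Longrightarrow> b \<in> F \<Longrightarrow> a \<preceq> b \<longleftrightarrow> \<iota> a \<le> \<iota> b"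
  using \<iota>_iso by (auto simp: tomonoid_isos_def iso_def hom_def lukasiewicz_unit_def)

lemma elt_F: "a \<in> {0..1} \<Longrightarrow> elt a \<in> F"
  using \<iota>_bij unfolding elt_def bij_betw_def by (metis inv_into_into)

lemma \<iota>_elt: "a \<in> {0..1} \<Longrightarrow> \<iota> (elt a) = a"
  using \<iota>_bij unfolding elt_def bij_betw_def by (metis f_inv_into_f)

lemma elt_\<iota>: "f \<in> F \<Longrightarrow> elt (\<iota> f) = f"
  using \<iota>_bij unfolding elt_def bij_betw_def by simp

lemma \<iota>_range: "f \<in> F \<Longrightarrow> \<iota> f \<in> {0..1}"
  using \<iota>_bij bij_betwE by blast

lemma elt_carrier: "a \<in> {0..1} \<Longrightarrow> elt a \<in> carrier L"
  by (simp add: F_carrier elt_F)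

lemma elt_1: "elt 1 = \<one>"
  using elt_\<iota>[OF F_one] \<iota>_one by simp

lemma elt_le: "a \<in> {0..1} \<Longrightarrow> b \<in> {0..1} \<Longrightarrow> elt a \<preceq> elt b \<longleftrightarrow> a \<le> b"
  by (simp only: \<iota>_le elt_F \<iota>_elt)

lemma elt_mult:
  assumes "a \<in> {0..1}" "b \<in> {0..1}"
  shows "elt a \<otimes> elt b = elt (max (a + b - 1) 0)"
proof -
  have "elt (\<iota> (elt a \<otimes> elt b)) = elt a \<otimes> elt b" using assms elt_F F_mult elt_\<iota> by simp
  then show ?thesis using assms by (simp only: \<iota>_mult elt_F \<iota>_elt)
qed

lemma elt_mult_mono:
  "a \<in> {0..1} \<Longrightarrow> b \<in> {0..1} \<Longrightarrow> a \<le> b \<Longrightarrow> x \<in> carrier L \<Longrightarrow> elt a \<otimes> x \<preceq> elt b \<otimes> x"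
  by (intro mult_left_le_mono) (simp_all add: elt_le elt_carrier)

lemma elt_mult_sup:
  assumes A: "A \<subseteq> {0..1}" "A \<noteq> {}" and x: "x \<in> carrier L"
  shows "is_sup L ((\<lambda>a. elt a \<otimes> x) ` A) (elt (Sup A) \<otimes> x)"
proof -
  have bdd: "bdd_above A" using A(1) by (meson bdd_above_Icc bdd_above_mono)
  obtain a0 where a0: "a0 \<in> A" using A(2) by blast
  have up: "a \<le> Sup A" if "a \<in> A" for a using cSup_upper[OF that bdd] .
  have Sup01: "Sup A \<in> {0..1}"
    using up[OF a0] a0 A cSup_least[of A 1] by force
  have "is_sup L (elt ` A) (elt (Sup A))"
    unfolding is_sup_def
  proof (intro conjI ballI impI)
    show "elt (Sup A) \<in> carrier L" using Sup01 by (rule elt_carrier)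
    show "a \<preceq> elt (Sup A)" if "a \<in> elt ` A" for a
      using that up A Sup01 by (auto simp only: elt_le subset_iff)
    fix u assume u: "u \<in> carrier L" "\<forall>a\<in>elt ` A. a \<preceq> u"
    then have "elt a0 \<preceq> u" using a0 by blast
    then have uF: "u \<in> F" using F_up[of "elt a0" u] elt_F u(1) a0 A(1) by blast
    have "a \<le> \<iota> u" if "a \<in> A" for a
      using u(2) that \<iota>_le[of "elt a" u] uF elt_F \<iota>_elt A(1) by auto
    then have "Sup A \<le> \<iota> u" using A(2) by (intro cSup_least)
    then have "elt (Sup A) \<preceq> elt (\<iota> u)" using elt_le Sup01 \<iota>_range uF by blast
    then show "elt (Sup A) \<preceq> u" using elt_\<iota> uF by simp
  qed
  moreover have "elt ` A \<subseteq> carrier L" using A(1) elt_carrier by blast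
  ultimately have "is_sup L ((\<lambda>b. b \<otimes> x) ` elt ` A) (elt (Sup A) \<otimes> x)"
    using mult_sup_right[OF x] A(2) by blast
  then show ?thesis by (simp add: image_image)
qed

lemma elt_0_le: "f \<in> F \<Longrightarrow> elt 0 \<preceq> f"
  using elt_le[of 0 "\<iota> f"] \<iota>_range[of f] elt_\<iota>[of f] by simp

lemma elt_0_mult_le:
  assumes "x \<in> R" "y \<in> R"
  shows "elt 0 \<otimes> x \<preceq> y"
proof -
  obtain f where f: "f \<in> F" "f \<otimes> x \<preceq> y" using R_below[OF assms] by blast
  then have "elt 0 \<otimes> x \<preceq> f \<otimes> x"
    using assms elt_0_le by (intro mult_left_le_mono) (simp_all add: elt_carrier F_carrier R_carrier)
  then show ?thesis
    using f assms tle_trans[of "elt 0 \<otimes> x" "f \<otimes> x" y]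
    by (simp add: elt_carrier F_carrier R_carrier)
qed

text \<open>\<open>R\<close> contains its supremum \<open>s\<close>: as the least element of \<open>F\<close> sends all of \<open>R\<close> below any given
  \<open>r \<in> R\<close>, the same is true for \<open>s\<close>, so that \<open>s\<close> is congruent to \<open>r\<close>.\<close>

lemma R_has_greatest: "\<exists>s\<in>R. \<forall>r\<in>R. r \<preceq> s"
proof -
  have Rc: "R \<subseteq> carrier L" using R_carrier by blast
  obtain s where s: "is_sup L R s" using sup_exists[OF Rc R_nonempty] by blast
  obtain r where r: "r \<in> R" using R_nonempty by blast
  have sc: "s \<in> carrier L" and ub: "\<And>x. x \<in> R \<Longrightarrow> x \<preceq> s" using s by (auto simp: is_sup_def)
  have "is_sup L ((\<lambda>b. elt 0 \<otimes> b) ` R) (elt 0 \<otimes> s)"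
    using mult_sup_left[OF _ Rc R_nonempty s] elt_carrier by simp
  then have "elt 0 \<otimes> s \<preceq> r"
    using r R_carrier elt_0_mult_le unfolding is_sup_def by blast
  then have "s \<in> R"
    using r sc ub[OF r] by (intro R_intro[of r s \<one> "elt 0"]) (simp_all add: F_one R_carrier elt_F)
  with ub show ?thesis by blast
qed

text \<open>The greatest element of \<open>R\<close>; it exists by the preceding lemma.\<close>

definition R_max :: 'a where
  "R_max = (SOME s. s \<in> R \<and> (\<forall>r\<in>R. r \<preceq> s))"

lemma R_max_in_R: "R_max \<in> R"
  and le_R_max: "r \<in> R \<Longrightarrow> r \<preceq> R_max"
  using R_has_greatest someI_ex[of "\<lambda>s. s \<in> R \<and> (\<forall>r\<in>R. r \<preceq> s)"]
  unfolding R_max_def by blast+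

lemma R_max_carrier: "R_max \<in> carrier L"
  using R_max_in_R by (rule R_carrier)

lemma elt_R_max_R: "a \<in> {0..1} \<Longrightarrow> elt a \<otimes> R_max \<in> R"
  by (simp add: R_mult elt_F R_max_in_R)

lemma elt_R_max_carrier: "a \<in> {0..1} \<Longrightarrow> elt a \<otimes> R_max \<in> carrier L"
  using elt_R_max_R R_carrier by blast

text \<open>The residual of \<open>r \<in> R\<close> is the largest \<open>a \<in> [0,1]\<close> that maps the greatest element of \<open>R\<close>
  below \<open>r\<close>.\<close>

definition residual :: "'a \<Rightarrow> real" where
  "residual r = Sup {a \<in> {0..1}. elt a \<otimes> R_max \<preceq> r}"

lemma residual:
  assumes r: "r \<in> R"
  shows residual_range: "residual r \<in> {0..1}"
    and le_residual_iff: "a \<in> {0..1} \<Longrightarrow> a \<le> residual r \<longleftrightarrow> elt a \<otimes> R_max \<preceq> r"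
proof -
  let ?A = "{a \<in> {0..1}. elt a \<otimes> R_max \<preceq> r}"
  have "0 \<in> ?A" using elt_0_mult_le[OF R_max_in_R r] by simp
  then have ne: "?A \<noteq> {}" by blast
  have bdd: "bdd_above ?A" by (rule bdd_aboveI[of _ 1]) simp
  have "0 \<le> residual r" unfolding residual_def using \<open>0 \<in> ?A\<close> bdd by (rule cSup_upper)
  moreover have "residual r \<le> 1" unfolding residual_def using ne by (rule cSup_least) simp
  ultimately show range: "residual r \<in> {0..1}" by simp
  have "is_sup L ((\<lambda>a. elt a \<otimes> R_max) ` ?A) (elt (residual r) \<otimes> R_max)"
    unfolding residual_def using ne by (intro elt_mult_sup) (auto simp: R_max_carrier)
  then have res: "elt (residual r) \<otimes> R_max \<preceq> r"
    using R_carrier[OF r] unfolding is_sup_def by blast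
  assume a: "a \<in> {0..1}"
  show "a \<le> residual r \<longleftrightarrow> elt a \<otimes> R_max \<preceq> r"
  proof
    assume "a \<le> residual r"
    then have "elt a \<otimes> R_max \<preceq> elt (residual r) \<otimes> R_max"
      using a range by (intro elt_mult_mono) (auto simp: R_max_carrier)
    then show "elt a \<otimes> R_max \<preceq> r"
      using res tle_trans R_carrier[OF r] elt_R_max_carrier a range by blast
  next
    assume "elt a \<otimes> R_max \<preceq> r"
    with a have "a \<in> ?A" by simp
    then show "a \<le> residual r" unfolding residual_def using bdd by (rule cSup_upper)
  qed
qed

text \<open>The translations of the greatest element fill \<open>R\<close> without gaps. Let \<open>a < 1\<close> be the residual of
  \<open>r\<close>. For every \<open>h\<close> with \<open>a < h < 1\<close> there is a \<open>b > a\<close> such that \<open>a\<close> is the Lukasiewicz product of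
  \<open>h\<close> and \<open>b\<close>. As \<open>b\<close> sends the greatest element above \<open>r\<close>, the element to which \<open>a\<close> sends it is at
  least the translate of \<open>r\<close> by \<open>h\<close>, and these translates have the supremum \<open>r\<close>.\<close>

lemma elt_residual:
  assumes r: "r \<in> R"
  shows "elt (residual r) \<otimes> R_max = r"
proof (rule tle_antisym)
  let ?a = "residual r"
  have a: "?a \<in> {0..1}" using residual_range[OF r] .
  show "elt ?a \<otimes> R_max \<preceq> r" using le_residual_iff[OF r a] by simp
  show "r \<preceq> elt ?a \<otimes> R_max"
  proof (cases "?a = 1")
    case True
    then show ?thesis using le_R_max[OF r] R_max_carrier by (simp add: elt_1)
  next
    case False
    have below: "elt h \<otimes> r \<preceq> elt ?a \<otimes> R_max" if h: "h \<in> {?a<..<1}" for h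
    proof -
      define b where "b = 1 - h + ?a"
      have b: "b \<in> {0..1}" "b > ?a" and h01: "h \<in> {0..1}" using h a by (auto simp: b_def)
      have "\<not> elt b \<otimes> R_max \<preceq> r" using le_residual_iff[OF r b(1)] b(2) by simp
      then have "r \<preceq> elt b \<otimes> R_max"
        using tle_total R_carrier[OF r] elt_R_max_carrier[OF b(1)] by blast
      then have "elt h \<otimes> r \<preceq> elt h \<otimes> (elt b \<otimes> R_max)"
        using h01 b(1) r by (intro mult_right_le_mono)
          (simp_all add: elt_carrier R_carrier R_max_carrier)
      also have "elt h \<otimes> (elt b \<otimes> R_max) = (elt h \<otimes> elt b) \<otimes> R_max"
        using h01 b(1) by (simp add: m_assoc elt_carrier R_max_carrier)
      also have "elt h \<otimes> elt b = elt ?a"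
        using elt_mult[OF h01 b(1)] a by (simp add: b_def)
      finally show ?thesis .
    qed
    have "?a < 1" using False a by simp
    then have "Sup {?a<..<1} = 1" "{?a<..<1} \<noteq> {}" by simp_all
    moreover have "{?a<..<1} \<subseteq> {0..1}" using a by auto
    ultimately have "is_sup L ((\<lambda>h. elt h \<otimes> r) ` {?a<..<1}) (elt 1 \<otimes> r)"
      using elt_mult_sup[of "{?a<..<1}" r] R_carrier[OF r] by simp
    then show ?thesis
      using below elt_R_max_carrier[OF a] R_carrier[OF r] by (auto simp: is_sup_def elt_1)
  qed
qed (use residual_range[OF r] r in \<open>simp_all add: elt_R_max_carrier R_carrier\<close>)

lemma residual_le_iff: "x \<in> R \<Longrightarrow> y \<in> R \<Longrightarrow> residual x \<le> residual y \<longleftrightarrow> x \<preceq> y"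
  using le_residual_iff[of y "residual x"] residual_range[of x] elt_residual[of x] by simp

text \<open>The residual of the least element of \<open>R\<close>.\<close>

definition least_residual :: real where
  "least_residual = residual (elt 0 \<otimes> R_max)"

lemma least_R: "elt 0 \<otimes> R_max \<in> R"
  by (simp add: elt_R_max_R)

lemma least_residual_le: "r \<in> R \<Longrightarrow> least_residual \<le> residual r"
  using residual_le_iff least_R elt_0_mult_le R_max_in_R by (simp add: least_residual_def)

lemma least_residual_range: "least_residual \<ge> 0" "least_residual < 1"
proof -
  have range: "least_residual \<in> {0..1}" unfolding least_residual_def by (rule residual_range[OF least_R])
  then show "least_residual \<ge> 0" by simp
  \<comment> \<open>Otherwise all residuals would be \<open>1\<close> and \<open>R\<close> would be a singleton.\<close>
  have "least_residual \<noteq> 1"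
  proof
    assume "least_residual = 1"
    then have top: "residual r = 1" if "r \<in> R" for r
      using least_residual_le[OF that] residual_range[OF that] by simp
    have "x = R_max" if "x \<in> R" for x
      using elt_residual[OF that] top[OF that] R_max_carrier by (simp add: elt_1)
    then have "R = {R_max}" using R_max_in_R by blast
    then show False using R_not_singleton is_singletonI by metis
  qed
  with range show "least_residual < 1" by simp
qed

text \<open>Two different labels can send the greatest element to the same element only if that is the
  least element of \<open>R\<close>.\<close>

lemma le_least_residual_if_collapse:
  assumes a: "a \<in> {0..1}" and b: "b \<in> {0..1}" and ab: "a < b"
    and eq: "elt a \<otimes> R_max = elt b \<otimes> R_max"
  shows "b \<le> least_residual"
proof -
  \<comment> \<open>Multiplication by \<open>h\<close> takes \<open>b\<close> to \<open>a\<close> and so fixes the translate of the greatest element; but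
    some power of \<open>h\<close> is \<open>0\<close>.\<close>
  define h where "h = 1 - (b - a)"
  define y where "y = elt b \<otimes> R_max"
  have h: "h \<in> {0..1}" "h < 1" using a b ab by (auto simp: h_def)
  have y: "y \<in> carrier L" using b by (simp add: y_def elt_R_max_carrier)
  have hy: "elt h \<otimes> y = y"
  proof -
    have "elt h \<otimes> y = (elt h \<otimes> elt b) \<otimes> R_max"
      using h b by (simp add: y_def m_assoc elt_carrier R_max_carrier)
    also have "elt h \<otimes> elt b = elt a" using elt_mult[OF h(1) b] a by (simp add: h_def)
    finally show ?thesis by (simp add: y_def eq)
  qed
  have pow: "elt (max (1 - real n * (1 - h)) 0) \<otimes> y = y" for n
  proof (induction n)
    case 0
    then show ?case using y by (simp add: elt_1)
  next
    case (Suc n)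
    let ?c = "max (1 - real n * (1 - h)) 0"
    have c: "?c \<in> {0..1}" using h by simp
    have "max (1 - real (Suc n) * (1 - h)) 0 = max (h + ?c - 1) 0"
      using h by (simp add: algebra_simps max_def)
    then have "elt (max (1 - real (Suc n) * (1 - h)) 0) = elt h \<otimes> elt ?c"
      using elt_mult[OF h(1) c] by simp
    then show ?case using Suc.IH hy y c h by (simp add: m_assoc elt_carrier)
  qed
  obtain n :: nat where "real n * (1 - h) > 1" using ex_less_of_nat_mult h(2) by (metis diff_gt_0_iff_gt)
  then have "elt 0 \<otimes> y = y" using pow[of n] by simp
  moreover have "elt 0 \<otimes> y \<preceq> elt 0 \<otimes> R_max"
    using b by (intro elt_0_mult_le) (simp_all add: y_def elt_R_max_R least_R)
  ultimately have "elt b \<otimes> R_max \<preceq> elt 0 \<otimes> R_max" by (simp add: y_def)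
  then show ?thesis using le_residual_iff[OF least_R b] by (simp add: least_residual_def)
qed

lemma residual_elt_R_max:
  assumes a: "a \<in> {0..1}"
  shows "residual (elt a \<otimes> R_max) = max a least_residual"
proof -
  let ?b = "residual (elt a \<otimes> R_max)"
  have R: "elt a \<otimes> R_max \<in> R" using a by (rule elt_R_max_R)
  have b: "?b \<in> {0..1}" using residual_range[OF R] .
  have "a \<le> ?b" using le_residual_iff[OF R a] tle_refl R_carrier[OF R] by blast
  moreover have "least_residual \<le> ?b" using least_residual_le[OF R] .
  moreover have "?b \<le> least_residual" if "a < ?b"
    using le_least_residual_if_collapse[OF a b that] elt_residual[OF R] by simp
  ultimately show ?thesis by linarith
qed

lemma residual_mult:
  assumes a: "a \<in> {0..1}" and r: "r \<in> R"
  shows "residual (elt a \<otimes> r) = max (a + residual r - 1) least_residual"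
proof -
  let ?b = "residual r"
  have b: "?b \<in> {0..1}" using residual_range[OF r] .
  have c: "max (a + ?b - 1) 0 \<in> {0..1}" using a b by auto
  have "elt a \<otimes> r = elt a \<otimes> (elt ?b \<otimes> R_max)" using elt_residual[OF r] by simp
  also have "\<dots> = elt (max (a + ?b - 1) 0) \<otimes> R_max"
    using a b by (simp add: elt_carrier R_max_carrier flip: elt_mult m_assoc)
  finally show ?thesis
    using residual_elt_R_max[OF c] least_residual_range(1) by simp
qed

text \<open>Rescaling the residuals, which range over \<open>[z,1]\<close> with \<open>z = least_residual\<close>, to \<open>[0,1]\<close> gives
  a c-isomorphism from \<open>\<Lambda>\<^sup>R\<close> to the canonical Lukasiewicz maps.\<close>

definition coordinate :: "'a \<Rightarrow> real" where
  "coordinate r = (residual r - least_residual) / (1 - least_residual)"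

lemma coordinate_order_iso: "coordinate \<in> order_isos R (\<preceq>) {0..1} (\<le>)"
proof -
  note z = least_residual_range
  have le: "coordinate x \<le> coordinate y \<longleftrightarrow> x \<preceq> y" if "x \<in> R" "y \<in> R" for x y
    using residual_le_iff[OF that] z by (simp add: coordinate_def divide_le_cancel)
  have "inj_on coordinate R"
    using le R_carrier by (intro inj_onI) (metis order_refl tle_antisym)
  moreover have "coordinate ` R = {0..1}"
  proof (intro equalityI subsetI)
    fix x assume "x \<in> coordinate ` R"
    then show "x \<in> {0..1}"
      using least_residual_le residual_range z by (auto simp: coordinate_def)
  next
    fix x :: real assume x: "x \<in> {0..1}"
    define p where "p = (1 - least_residual) * x"
    define a where "a = least_residual + p"
    have "p \<le> (1 - least_residual) * 1" "0 \<le> p"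
      unfolding p_def using x z by (intro mult_left_mono mult_nonneg_nonneg; simp)+
    then have a: "a \<in> {0..1}" "least_residual \<le> a"
      using z by (simp_all add: a_def)
    have "coordinate (elt a \<otimes> R_max) = x"
      using a z by (simp add: coordinate_def residual_elt_R_max) (simp add: a_def p_def)
    then show "x \<in> coordinate ` R" using elt_R_max_R[OF a(1)] by blast
  qed
  ultimately show ?thesis using le by (simp add: order_isos_def bij_betw_def)
qed

lemma transport_coordinate:
  assumes a: "a \<in> {0..1}"
  shows "transport coordinate R {0..1} (rho L R (elt a)) =
    (\<lambda>x\<in>{0..1}. max (x + max (1 - (1 - a) / (1 - least_residual)) 0 - 1) 0)"
proof -
  note z = least_residual_range
  have bij: "bij_betw coordinate R {0..1}" using coordinate_order_iso by (simp add: order_isos_def)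
  have "coordinate (rho L R (elt a) (inv_into R coordinate x)) =
    max (x + max (1 - (1 - a) / (1 - least_residual)) 0 - 1) 0" if x: "x \<in> {0..1}" for x
  proof -
    define r where "r = inv_into R coordinate x"
    have r: "r \<in> R" "coordinate r = x"
      using bij x by (auto simp: r_def bij_betw_def inv_into_into f_inv_into_f)
    have "coordinate (rho L R (elt a) r) =
        (max (a + residual r - 1) least_residual - least_residual) / (1 - least_residual)"
      using a r by (simp add: rho_apply elt_F coordinate_def residual_mult)
    also have "\<dots> = max ((a + residual r - 1 - least_residual) / (1 - least_residual)) 0"
      using z by (auto simp: max_def divide_le_0_iff)
    also have "(a + residual r - 1 - least_residual) / (1 - least_residual) =
        x - (1 - a) / (1 - least_residual)"
      using z by (simp add: r(2)[symmetric] coordinate_def diff_divide_distrib add_divide_distrib)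
    finally show ?thesis using x by (auto simp: r_def[symmetric] max_def)
  qed
  then show ?thesis by (auto simp: transport_def)
qed

lemma lukasiewicz_ct_Lam: "lukasiewicz_ct R (\<preceq>) (Lam L F R)"
proof -
  note z = least_residual_range
  let ?t = "\<lambda>a. max (1 - (1 - a) / (1 - least_residual)) 0"
  have F_eq: "F = elt ` {0..1}"
    using elt_F elt_\<iota> \<iota>_range by (auto simp: image_iff) (metis atLeastAtMost_iff)
  have "Lam L F R = (\<lambda>a. rho L R (elt a)) ` {0..1}"
    using arg_cong[OF F_eq, of "image (rho L R)"] by (simp only: Lam_def image_image)
  then have "transport coordinate R {0..1} ` Lam L F R =
      (\<lambda>a. \<lambda>x\<in>{0..1}. max (x + ?t a - 1) 0) ` {0..1}"
    by (simp only: image_image transport_coordinate cong: image_cong)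
  also have "\<dots> = (\<lambda>t. \<lambda>x\<in>{0..1}. max (x + t - 1) 0) ` ?t ` {0..1}" by (simp add: image_image)
  also have "?t ` {0..1} = {0..1}"
  proof (intro equalityI subsetI)
    fix t assume "t \<in> ?t ` {0..1}"
    then show "t \<in> {0..1}" using z by auto
  next
    fix t :: real assume t: "t \<in> {0..1}"
    have "(1 - least_residual) * (1 - t) \<le> 1 * 1" using t z by (intro mult_mono) auto
    then have "1 - (1 - least_residual) * (1 - t) \<in> {0..1}" using t z by auto
    moreover have "t = ?t (1 - (1 - least_residual) * (1 - t))" using t z by simp
    ultimately show "t \<in> ?t ` {0..1}" by blast
  qed
  finally have "lukasiewicz_maps = transport coordinate R {0..1} ` Lam L F R"
    unfolding lukasiewicz_maps_def by (rule sym)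
  then have "coordinate \<in> c_isos R (\<preceq>) (Lam L F R) {0..1} (\<le>) lukasiewicz_maps"
    using coordinate_order_iso by (simp only: c_isos_def mem_Collect_eq)
  with composition_tomonoid_Lam show ?thesis by (auto simp: lukasiewicz_ct_def)
qed

end

section \<open>The translations in coordinates\<close>

lemma lukasiewicz_unit_simps:
  "carrier lukasiewicz_unit = {0..1}" "tle lukasiewicz_unit = (\<le>)"
  "a \<otimes>\<^bsub>lukasiewicz_unit\<^esub> b = max (a + b - 1) 0"
  by (simp_all add: lukasiewicz_unit_def)

lemma product_unit_simps:
  "carrier product_unit = {0<..1}" "tle product_unit = (\<le>)" "a \<otimes>\<^bsub>product_unit\<^esub> b = a * b"
  by (simp_all add: product_unit_def)

lemma lukasiewicz_maps_comp:
  fixes s t x :: real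
  assumes "s \<in> {0..1}" "t \<in> {0..1}" "x \<in> {0..1}"
  shows "max (max (x + t - 1) 0 + s - 1) 0 = max (x + max (s + t - 1) 0 - 1) 0"
  using assms by (auto simp: max_def)

lemma capped_shift:
  fixes r b :: real
  assumes "r \<in> {0..1}"
  shows "max (r + max (1 + b) 0 - 1) 0 = max (r + b) 0"
  using assms by (auto simp: max_def)

lemma lukasiewicz_maps_order:
  fixes s t :: real
  assumes "s \<in> {0..1}" "t \<in> {0..1}"
    and "\<And>x. x \<in> {0..1} \<Longrightarrow> max (x + s - 1) 0 \<le> max (x + t - 1) 0"
  shows "s \<le> t"
  using assms(3)[of 1] assms(1,2) by simp

lemma reversed_product_map_eq:
  fixes t x :: real
  assumes "t > 0"
  shows "max (x + t - 1) 0 / t = max (1 - (1 - x) / t) 0"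
  using assms by (auto simp: max_def field_simps)

lemma reversed_product_maps_comp:
  fixes s t x :: real
  assumes "s \<in> {0<..1}" "t \<in> {0<..1}"
  shows "max (max (x + t - 1) 0 / t + s - 1) 0 / s = max (x + s * t - 1) 0 / (s * t)"
proof -
  define u where "u = (1 - x) / t"
  have "max (1 - (1 - max (1 - u) 0) / s) 0 = max (1 - u / s) 0"
  proof (cases "u \<le> 1")
    case False
    then have "1 \<le> 1 / s" "1 / s \<le> u / s" using assms by (auto simp: divide_right_mono)
    with False show ?thesis by simp
  qed simp
  moreover have "u / s = (1 - x) / (s * t)" by (simp add: u_def mult.commute)
  ultimately show ?thesis using assms by (simp add: reversed_product_map_eq u_def mult.commute)
qed

lemma reversed_product_maps_order:
  fixes s t :: real
  assumes s: "s \<in> {0<..1}" and t: "t \<in> {0<..1}"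
    and le: "\<And>x. x \<in> {0..<1} \<Longrightarrow> max (x + s - 1) 0 / s \<le> max (x + t - 1) 0 / t"
  shows "s \<le> t"
proof -
  have "max (1 - (1 - x) / s) 0 \<le> max (1 - (1 - x) / t) 0" if "x \<in> {0..<1}" for x
    using le[OF that] s t by (simp only: reversed_product_map_eq greaterThanAtMost_iff)
  \<comment> \<open>At \<open>1 - t / 2\<close> the map with parameter \<open>t\<close> has the value \<open>1 / 2\<close>, above the cut-off.\<close>
  from this[of "1 - t / 2"] have "max (1 - t / (2 * s)) 0 \<le> 1 / 2" using s t by simp
  then have "1 / 2 \<le> t / (2 * s)" by linarith
  then show ?thesis using s by (simp add: field_simps)
qed

lemma power_maps_order:
  fixes s t :: real
  assumes s: "s \<in> {0<..1}" and t: "t \<in> {0<..1}"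
    and le: "\<And>x. x \<in> {0<..<1} \<Longrightarrow> x powr (1 / s) \<le> x powr (1 / t)"
  shows "s \<le> t"
proof (rule ccontr)
  assume "\<not> s \<le> t"
  then have "1 / s < 1 / t" using s t by (intro divide_strict_left_mono) auto
  then have "(1 / 2 :: real) powr (1 / t) < (1 / 2) powr (1 / s)" by (intro powr_less_mono') auto
  with le[of "1 / 2"] show False by simp
qed

context filter_class
begin

lemma translations_lukasiewicz_lukasiewicz:
  assumes \<iota>: "\<iota> \<in> tomonoid_isos (L\<lparr>carrier := F\<rparr>) lukasiewicz_unit"
    and \<phi>: "\<phi> \<in> c_isos R (\<preceq>) (Lam L F R) {0..1} (\<le>) lukasiewicz_maps"
  shows "\<exists>\<alpha>\<ge>1. \<forall>f\<in>F. transport \<phi> R {0..1} (rho L R f) =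
    (\<lambda>r\<in>{0..1}. max (r + \<alpha> * (\<iota> f - 1)) 0)"
proof (rule translation_parameter[where mul = "\<lambda>s t. max (s + t - 1) 0",
      OF \<iota> lukasiewicz_unit_simps(2) \<phi>[unfolded lukasiewicz_maps_def]])
  fix T
  assume T: "T ` carrier lukasiewicz_unit = {0..1}"
    "\<And>a b. a \<in> carrier lukasiewicz_unit \<Longrightarrow> b \<in> carrier lukasiewicz_unit \<Longrightarrow> a \<le> b \<Longrightarrow> T a \<le> T b"
    "\<And>a b. a \<in> carrier lukasiewicz_unit \<Longrightarrow> b \<in> carrier lukasiewicz_unit \<Longrightarrow>
       T (a \<otimes>\<^bsub>lukasiewicz_unit\<^esub> b) = max (T a + T b - 1) 0"
    and rep: "\<And>f. f \<in> F \<Longrightarrow> \<iota> f \<in> carrier lukasiewicz_unit \<and> T (\<iota> f) \<in> {0..1} \<and>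
      transport \<phi> R {0..1} (rho L R f) = (\<lambda>x\<in>{0..1}. max (x + T (\<iota> f) - 1) 0)"
  obtain \<alpha> where \<alpha>: "\<alpha> \<ge> 1" "\<And>a. a \<in> {0..1} \<Longrightarrow> T a = max (1 + \<alpha> * (a - 1)) 0"
    using lukasiewicz_to_lukasiewicz[OF T[unfolded lukasiewicz_unit_simps]] by blast
  have "transport \<phi> R {0..1} (rho L R f) = (\<lambda>r\<in>{0..1}. max (r + \<alpha> * (\<iota> f - 1)) 0)"
    if f: "f \<in> F" for f
  proof -
    have "T (\<iota> f) = max (1 + \<alpha> * (\<iota> f - 1)) 0"
      using rep[OF f] \<alpha>(2) by (simp add: lukasiewicz_unit_simps)
    then show ?thesis
      using rep[OF f] by (simp add: capped_shift cong: restrict_cong)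
  qed
  with \<alpha>(1) show ?thesis by blast
next
  show "max (max (x + t - 1) 0 + s - 1) 0 = max (x + max (s + t - 1) 0 - 1) 0"
    if "s \<in> {0..1}" "t \<in> {0..1}" "x \<in> {0..1}" for s t x :: real
    using that by (rule lukasiewicz_maps_comp)
  show "s \<le> t" if "s \<in> {0..1}" "t \<in> {0..1}"
    "\<And>x. x \<in> {0..1} \<Longrightarrow> max (x + s - 1) 0 \<le> max (x + t - 1) 0" for s t :: real
    using that by (rule lukasiewicz_maps_order)
qed simp

lemma translations_product_lukasiewicz:
  assumes \<iota>: "\<iota> \<in> tomonoid_isos (L\<lparr>carrier := F\<rparr>) product_unit"
    and \<phi>: "\<phi> \<in> c_isos R (\<preceq>) (Lam L F R) {0..1} (\<le>) lukasiewicz_maps"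
  shows "\<exists>\<alpha>>0. \<forall>f\<in>F. transport \<phi> R {0..1} (rho L R f) =
    (\<lambda>r\<in>{0..1}. max (r + \<alpha> * ln (\<iota> f)) 0)"
proof (rule translation_parameter[where mul = "\<lambda>s t. max (s + t - 1) 0",
      OF \<iota> product_unit_simps(2) \<phi>[unfolded lukasiewicz_maps_def]])
  fix T
  assume T: "T ` carrier product_unit = {0..1}"
    "\<And>a b. a \<in> carrier product_unit \<Longrightarrow> b \<in> carrier product_unit \<Longrightarrow> a \<le> b \<Longrightarrow> T a \<le> T b"
    "\<And>a b. a \<in> carrier product_unit \<Longrightarrow> b \<in> carrier product_unit \<Longrightarrow>
       T (a \<otimes>\<^bsub>product_unit\<^esub> b) = max (T a + T b - 1) 0"
    and rep: "\<And>f. f \<in> F \<Longrightarrow> \<iota> f \<in> carrier product_unit \<and> T (\<iota> f) \<in> {0..1} \<and>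
      transport \<phi> R {0..1} (rho L R f) = (\<lambda>x\<in>{0..1}. max (x + T (\<iota> f) - 1) 0)"
  obtain \<alpha> where \<alpha>: "\<alpha> > 0" "\<And>a. a \<in> {0<..1} \<Longrightarrow> T a = max (1 + \<alpha> * ln a) 0"
    using product_to_lukasiewicz[OF T[unfolded product_unit_simps]] by blast
  have "transport \<phi> R {0..1} (rho L R f) = (\<lambda>r\<in>{0..1}. max (r + \<alpha> * ln (\<iota> f)) 0)"
    if f: "f \<in> F" for f
  proof -
    have "T (\<iota> f) = max (1 + \<alpha> * ln (\<iota> f)) 0"
      using rep[OF f] \<alpha>(2) by (simp add: product_unit_simps)
    then show ?thesis
      using rep[OF f] by (simp add: capped_shift cong: restrict_cong)
  qed
  with \<alpha>(1) show ?thesis by blast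
next
  show "max (max (x + t - 1) 0 + s - 1) 0 = max (x + max (s + t - 1) 0 - 1) 0"
    if "s \<in> {0..1}" "t \<in> {0..1}" "x \<in> {0..1}" for s t x :: real
    using that by (rule lukasiewicz_maps_comp)
  show "s \<le> t" if "s \<in> {0..1}" "t \<in> {0..1}"
    "\<And>x. x \<in> {0..1} \<Longrightarrow> max (x + s - 1) 0 \<le> max (x + t - 1) 0" for s t :: real
    using that by (rule lukasiewicz_maps_order)
qed simp

text \<open>In the product, reversed product and power families, composition multiplies the parameters as
  real numbers; the parameter of the translation by \<open>f\<close> is then a fixed power of the label of \<open>f\<close>.
  The positivity of the label serves to rewrite quotients by this power.\<close>

lemma translations_product_powr:
  fixes S :: "real set" and g :: "real \<Rightarrow> real \<Rightarrow> real"
  assumes \<iota>: "\<iota> \<in> tomonoid_isos (L\<lparr>carrier := F\<rparr>) product_unit"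
    and \<phi>: "\<phi> \<in> c_isos R (\<preceq>) (Lam L F R) S (\<le>) ((\<lambda>t. \<lambda>x\<in>S. g t x) ` {0<..1})"
    and comp: "\<And>s t x. s \<in> {0<..1} \<Longrightarrow> t \<in> {0<..1} \<Longrightarrow> x \<in> S \<Longrightarrow> g s (g t x) = g (s * t) x"
    and ord: "\<And>s t. s \<in> {0<..1} \<Longrightarrow> t \<in> {0<..1} \<Longrightarrow> (\<And>x. x \<in> S \<Longrightarrow> g s x \<le> g t x) \<Longrightarrow> s \<le> t"
  shows "\<exists>\<alpha>>0. \<forall>f\<in>F. \<iota> f > 0 \<and>
    transport \<phi> R S (rho L R f) = (\<lambda>r\<in>S. g (\<iota> f powr \<alpha>) r)"
proof (rule translation_parameter[where mul = "(*)", OF \<iota> product_unit_simps(2) \<phi>])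
  fix T
  assume T: "T ` carrier product_unit = {0<..1}"
    "\<And>a b. a \<in> carrier product_unit \<Longrightarrow> b \<in> carrier product_unit \<Longrightarrow> a \<le> b \<Longrightarrow> T a \<le> T b"
    "\<And>a b. a \<in> carrier product_unit \<Longrightarrow> b \<in> carrier product_unit \<Longrightarrow>
       T (a \<otimes>\<^bsub>product_unit\<^esub> b) = T a * T b"
    and rep: "\<And>f. f \<in> F \<Longrightarrow> \<iota> f \<in> carrier product_unit \<and> T (\<iota> f) \<in> {0<..1} \<and>
      transport \<phi> R S (rho L R f) = (\<lambda>x\<in>S. g (T (\<iota> f)) x)"
  obtain \<alpha> where \<alpha>: "\<alpha> > 0" "\<And>a. a \<in> {0<..1} \<Longrightarrow> T a = a powr \<alpha>"
    using product_to_product[OF T[unfolded product_unit_simps]] by blast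
  have "\<iota> f > 0 \<and> transport \<phi> R S (rho L R f) = (\<lambda>r\<in>S. g (\<iota> f powr \<alpha>) r)" if f: "f \<in> F" for f
  proof -
    have "\<iota> f \<in> {0<..1}" using rep[OF f] by (simp add: product_unit_simps)
    then show ?thesis using rep[OF f] \<alpha>(2)[of "\<iota> f"] by simp
  qed
  with \<alpha>(1) show ?thesis by blast
next
  show "s * t \<in> {0<..1}" if "s \<in> {0<..1}" "t \<in> {0<..1}" for s t :: real
    using that by (simp add: mult_le_one)
qed (fact comp, fact ord)

lemma translations_product_product:
  assumes \<iota>: "\<iota> \<in> tomonoid_isos (L\<lparr>carrier := F\<rparr>) product_unit"
    and \<phi>: "\<phi> \<in> c_isos R (\<preceq>) (Lam L F R) {0<..1} (\<le>) product_maps"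
  shows "\<exists>\<alpha>>0. \<forall>f\<in>F. transport \<phi> R {0<..1} (rho L R f) = (\<lambda>r\<in>{0<..1}. \<iota> f powr \<alpha> * r)"
proof -
  have "\<exists>\<alpha>>0. \<forall>f\<in>F. \<iota> f > 0 \<and>
      transport \<phi> R {0<..1} (rho L R f) = (\<lambda>r\<in>{0<..1}. \<iota> f powr \<alpha> * r)"
  proof (rule translations_product_powr[OF \<iota> \<phi>[unfolded product_maps_def]])
    fix s t :: real
    assume "\<And>x. x \<in> {0<..1} \<Longrightarrow> s * x \<le> t * x"
    from this[of 1] show "s \<le> t" by simp
  qed simp
  then show ?thesis by blast
qed

lemma translations_product_reversed_product:
  assumes \<iota>: "\<iota> \<in> tomonoid_isos (L\<lparr>carrier := F\<rparr>) product_unit"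
    and \<phi>: "\<phi> \<in> c_isos R (\<preceq>) (Lam L F R) {0..<1} (\<le>) reversed_product_maps"
  shows "\<exists>\<alpha>>0. \<forall>f\<in>F. transport \<phi> R {0..<1} (rho L R f) =
    (\<lambda>r\<in>{0..<1}. max (1 - (1 - r) / \<iota> f powr \<alpha>) 0)"
proof -
  have "\<exists>\<alpha>>0. \<forall>f\<in>F. \<iota> f > 0 \<and> transport \<phi> R {0..<1} (rho L R f) =
      (\<lambda>r\<in>{0..<1}. max (r + \<iota> f powr \<alpha> - 1) 0 / \<iota> f powr \<alpha>)"
    by (rule translations_product_powr[OF \<iota> \<phi>[unfolded reversed_product_maps_def]])
      (erule (1) reversed_product_maps_comp reversed_product_maps_order, blast?)+
  then obtain \<alpha> where \<alpha>: "\<alpha> > 0" "\<And>f. f \<in> F \<Longrightarrow> \<iota> f > 0 \<and> transport \<phi> R {0..<1} (rho L R f) =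
      (\<lambda>r\<in>{0..<1}. max (r + \<iota> f powr \<alpha> - 1) 0 / \<iota> f powr \<alpha>)"
    by blast
  have "transport \<phi> R {0..<1} (rho L R f) =
    (\<lambda>r\<in>{0..<1}. max (1 - (1 - r) / \<iota> f powr \<alpha>) 0)" if "f \<in> F" for f
    using \<alpha>(2)[OF that] by (simp add: reversed_product_map_eq)
  with \<alpha>(1) show ?thesis by blast
qed

lemma translations_product_power:
  assumes \<iota>: "\<iota> \<in> tomonoid_isos (L\<lparr>carrier := F\<rparr>) product_unit"
    and \<phi>: "\<phi> \<in> c_isos R (\<preceq>) (Lam L F R) {0<..<1} (\<le>) power_maps"
  shows "\<exists>\<alpha>>0. \<forall>f\<in>F. transport \<phi> R {0<..<1} (rho L R f) =
    (\<lambda>r\<in>{0<..<1}. r powr (1 / \<iota> f powr \<alpha>))"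
proof -
  have "\<exists>\<alpha>>0. \<forall>f\<in>F. \<iota> f > 0 \<and> transport \<phi> R {0<..<1} (rho L R f) =
      (\<lambda>r\<in>{0<..<1}. r powr (1 / \<iota> f powr \<alpha>))"
  proof (rule translations_product_powr[OF \<iota> \<phi>[unfolded power_maps_def]])
    show "(x powr (1 / t)) powr (1 / s) = x powr (1 / (s * t))" for s t x :: real
      by (simp add: powr_powr mult.commute)
  qed (rule power_maps_order)
  then show ?thesis by blast
qed

end

section \<open>The classification\<close>

theorem theorem4p7:
  fixes L :: "('a, 'm) tomonoid_scheme" and F R :: "'a set"
  assumes "qnc_tomonoid L" and "\<not> trivial_tomonoid L"
    and "tomonoid_filter L F" and "\<not> trivial_tomonoid (L\<lparr>carrier := F\<rparr>)"
    and "archimedean (L\<lparr>carrier := F\<rparr>)"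
    and "\<forall>S\<in>carrier (filter_quotient L F).
           \<exists>I. real_interval I \<and> order_isos S (tle L) I (\<le>) \<noteq> {}"
    and "R \<in> carrier (filter_quotient L F)" and "\<not> is_singleton R"
  shows
    "(lukasiewicz_tomonoid (L\<lparr>carrier := F\<rparr>) \<longrightarrow>
       lukasiewicz_ct R (tle L) (Lam L F R) \<and>
       (\<forall>\<iota>\<in>tomonoid_isos (L\<lparr>carrier := F\<rparr>) lukasiewicz_unit.
        \<forall>\<phi>\<in>c_isos R (tle L) (Lam L F R) {0..1} (\<le>) lukasiewicz_maps.
        \<exists>\<alpha>\<ge>1. \<forall>f\<in>F. transport \<phi> R {0..1} (rho L R f) =
          (\<lambda>r\<in>{0..1}. max (r + \<alpha> * (\<iota> f - 1)) 0)))
     \<and>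
     (product_tomonoid (L\<lparr>carrier := F\<rparr>) \<and> lukasiewicz_ct R (tle L) (Lam L F R) \<longrightarrow>
       (\<forall>\<iota>\<in>tomonoid_isos (L\<lparr>carrier := F\<rparr>) product_unit.
        \<forall>\<phi>\<in>c_isos R (tle L) (Lam L F R) {0..1} (\<le>) lukasiewicz_maps.
        \<exists>\<alpha>>0. \<forall>f\<in>F. transport \<phi> R {0..1} (rho L R f) =
          (\<lambda>r\<in>{0..1}. max (r + \<alpha> * ln (\<iota> f)) 0)))
     \<and>
     (product_tomonoid (L\<lparr>carrier := F\<rparr>) \<and> product_ct R (tle L) (Lam L F R) \<longrightarrow>
       (\<forall>\<iota>\<in>tomonoid_isos (L\<lparr>carrier := F\<rparr>) product_unit.
        \<forall>\<phi>\<in>c_isos R (tle L) (Lam L F R) {0<..1} (\<le>) product_maps.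
        \<exists>\<alpha>>0. \<forall>f\<in>F. transport \<phi> R {0<..1} (rho L R f) =
          (\<lambda>r\<in>{0<..1}. \<iota> f powr \<alpha> * r)))
     \<and>
     (product_tomonoid (L\<lparr>carrier := F\<rparr>) \<and> reversed_product_ct R (tle L) (Lam L F R) \<longrightarrow>
       (\<forall>\<iota>\<in>tomonoid_isos (L\<lparr>carrier := F\<rparr>) product_unit.
        \<forall>\<phi>\<in>c_isos R (tle L) (Lam L F R) {0..<1} (\<le>) reversed_product_maps.
        \<exists>\<alpha>>0. \<forall>f\<in>F. transport \<phi> R {0..<1} (rho L R f) =
          (\<lambda>r\<in>{0..<1}. max (1 - (1 - r) / \<iota> f powr \<alpha>) 0)))
     \<and>
     (product_tomonoid (L\<lparr>carrier := F\<rparr>) \<and> power_ct R (tle L) (Lam L F R) \<longrightarrow>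
       (\<forall>\<iota>\<in>tomonoid_isos (L\<lparr>carrier := F\<rparr>) product_unit.
        \<forall>\<phi>\<in>c_isos R (tle L) (Lam L F R) {0<..<1} (\<le>) power_maps.
        \<exists>\<alpha>>0. \<forall>f\<in>F. transport \<phi> R {0<..<1} (rho L R f) =
          (\<lambda>r\<in>{0<..<1}. r powr (1 / \<iota> f powr \<alpha>))))"
proof -
  interpret filter_class L F R
    using assms(1,3,7) by (simp add: filter_class_def filter_class_axioms_def)
  have "lukasiewicz_ct R (tle L) (Lam L F R)" if luk: "lukasiewicz_tomonoid (L\<lparr>carrier := F\<rparr>)"
  proof -
    obtain \<iota> where "\<iota> \<in> tomonoid_isos (L\<lparr>carrier := F\<rparr>) lukasiewicz_unit"
      using luk by (auto simp: lukasiewicz_tomonoid_def)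
    then interpret lukasiewicz_filter_class L F R \<iota>
      using assms(8) by unfold_locales
    show ?thesis by (rule lukasiewicz_ct_Lam)
  qed
  then show ?thesis
    using translations_lukasiewicz_lukasiewicz translations_product_lukasiewicz
      translations_product_product translations_product_reversed_product
      translations_product_power
    by (intro conjI impI ballI) simp_all
qed

end
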